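(* Let $s \in (\tfrac{1}{2},1]$ and $t \in (0,2)$, and write $\zeta(s,t) = \min\{t + (2s - 1),s + 1\}$. For every $0 \leq \zeta < \zeta(s,t)$ there exists a constant $C = C(s,t,\zeta) > 0$ such that the following holds. Let $\mu$ be a Borel measure on $B(1) \subset \mathbb{R}^2$ with $I_{t}(\mu) \leq 1$, and let $\sigma$ be a Borel measure on $\mathbb{P} = \{(x,x^{2}) : x \in [-1,1]\}$ satisfying $\sigma(B(x,r)) \leq r^{s}$ for all $x \in \mathbb{R}^{2}$ and $r > 0$. Then $$I_{\zeta}(\mu \ast \sigma) \leq C.$$
   Context: $B(x,r)$ is the ball in $\mathbb{R}^2$ of centre $x$ and radius $r$, and $B(1) = B(0,1)$. For a Borel measure $\nu$ on $\mathbb{R}^2$ and $u \geq 0$, $I_u(\nu) = \iint |x-y|^{-u} \, d\nu(x) \, d\nu(y)$ is the $u$-dimensional Riesz energy. *)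

theory Defs
  imports "HOL-Analysis.Analysis" "HOL-Probability.Convolution"
begin

(* The kernel |x - y|^(-u) with values in [0, \<infinity>], for u \<ge> 0. On the diagonal it is
   \<infinity> for u > 0 and 1 for u = 0; powr alone would give 0 there in both cases,
   because 0 powr a = 0. *)
definition riesz_kernel :: "real \<Rightarrow> real^2 \<Rightarrow> real^2 \<Rightarrow> ennreal" where
  "riesz_kernel u x y =
     (if x = y then (if u = 0 then 1 else \<infinity>) else ennreal (dist x y powr (- u)))"

definition riesz_energy :: "real \<Rightarrow> (real^2) measure \<Rightarrow> ennreal" where
  "riesz_energy u \<nu> = (\<integral>\<^sup>+ x. \<integral>\<^sup>+ y. riesz_kernel u x y \<partial>\<nu> \<partial>\<nu>)"

(* A Borel measure on A is represented by its extension by zero to the whole plane. *)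
definition borel_measure_on :: "(real^2) set \<Rightarrow> (real^2) measure \<Rightarrow> bool" where
  "borel_measure_on A \<nu> \<longleftrightarrow> sets \<nu> = sets borel \<and> (AE x in \<nu>. x \<in> A)"

definition parabola :: "(real^2) set" where
  "parabola = {vector [x, x\<^sup>2] | x. x \<in> {-1..1}}"

end

theory Submission
  imports Defs
begin

text \<open>
  Write \<open>\<nu> = \<mu> * \<sigma>\<close> and \<open>m = \<mu> * \<pi>\<close>, where \<open>\<pi>\<close> has a Lipschitz density \<open>\<psi>(a) da\<close> along a slightly longer
  parabola. Let \<open>\<nu>(d, w)\<close> be the mass of the square of side \<open>d\<close> at \<open>w\<close>, let \<open>A(d)\<close> be the integral of
  \<open>\<nu>(d, w)\<^sup>2\<close> and \<open>E(d)\<close> that of \<open>\<nu>(d, w) m(d, w)\<close>. The Frostman condition gives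
  \<open>\<nu>(d, w) \<le> 4 d\<^bsup>s-1\<^esup> m(4d, w')\<close> pointwise, hence \<open>A(d) \<le> 4 d\<^bsup>s-1\<^esup> E(4d)\<close>. This domination is lossy at
  coarse scales, so \<open>E\<close> is compared with its value at the next coarser scale instead: a square of side
  \<open>2d\<close> consists of four of side \<open>d\<close>, so \<open>16 E(d) - E(2d)\<close> is controlled, through Cauchy-Schwarz, by \<open>A(d)\<close> and
  by the $L^2$ norm of \<open>m(d, w) - m(d, w + e)\<close> with \<open>\<bar>e\<bar> \<le> d\<close>. The latter is small: by curvature \<open>\<pi>\<close> convolved
  with its reflection has a density which at \<open>z\<close> has size \<open>1/\<bar>z\<bar>\<close> and gradient \<open>1/\<bar>z\<bar>\<^sup>2\<close>, and so the square
  of the norm is at most a constant times \<open>d\<^bsup>t+3\<^esup> I\<^sub>t(\<mu>)\<close>, for every \<open>0 \<le> t \<le> 2\<close>. Running the resulting recursion over dyadic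
  scales yields \<open>A(d) \<le> M d\<^bsup>z+2\<^esup>\<close> for every \<open>z\<close> below both \<open>2s + t - 1\<close> and \<open>s + 1\<close>, and summing over
  scales bounds the energy.
\<close>

subsection \<open>The self-correlation of the parabola\<close>

text \<open>The autocorrelation of the indicator of an interval of length \<open>d\<close>: the
  overlap of two such intervals displaced by \<open>z\<close>.\<close>

definition tent :: "real \<Rightarrow> real \<Rightarrow> real" where
  "tent d z = max 0 (d - \<bar>z\<bar>)"

text \<open>A trapezoid equal to 1 on \<open>{-2..2}\<close>. The plateau exceeds
  \<open>{-1..1}\<close>, so that short arcs around every point of \<open>parabola\<close> carry
  full weight; the Lipschitz flanks keep the self-correlation Lipschitz away from the
  origin.\<close>

definition cutoff :: "real \<Rightarrow> real" where
  "cutoff a = max 0 (min 1 (3 - \<bar>a\<bar>))"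

text \<open>
  The image of \<open>cutoff a * cutoff b * da * db\<close> under \<open>(a, b) \<mapsto> (a - b, a\<^sup>2 - b\<^sup>2)\<close> has this density: with
  \<open>h = a - b\<close> and midpoint \<open>c = (a + b) / 2\<close> the second coordinate is \<open>v = 2 * h * c\<close>.
  Division by zero gives the value 0 on the null line \<open>h = 0\<close>.
\<close>
definition difference_density :: "real \<Rightarrow> real \<Rightarrow> real" where
  "difference_density h v = cutoff (v / (2 * h) + h / 2) * cutoff (v / (2 * h) - h / 2) / (2 * \<bar>h\<bar>)"

lemma tent_measurable [measurable]: "tent d \<in> borel_measurable borel"
  unfolding tent_def by measurable

lemma cutoff_measurable [measurable]: "cutoff \<in> borel_measurable borel"
  unfolding cutoff_def by measurable

lemma tent_nonneg: "0 \<le> tent d z"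
  by (simp add: tent_def)

lemma cutoff_bounds: "0 \<le> cutoff a" "cutoff a \<le> 1"
  by (auto simp: cutoff_def)

lemma difference_density_nonneg: "0 \<le> difference_density h v"
  by (simp add: difference_density_def cutoff_bounds)

lemma cutoff_lipschitz: "\<bar>cutoff a - cutoff b\<bar> \<le> \<bar>a - b\<bar>"
  by (auto simp: cutoff_def max_def min_def abs_if)

lemma cutoff_eq_0: "\<bar>a\<bar> \<ge> 3 \<Longrightarrow> cutoff a = 0"
  by (auto simp: cutoff_def)

text \<open>
  On the support of the density \<open>\<bar>v\<bar> \<le> 6 * \<bar>h\<bar>\<close>, so that \<open>\<bar>h\<bar>\<close> is comparable to the norm of \<open>(h, v)\<close>.
\<close>
lemma difference_density_lipschitz:
  assumes hh': "\<bar>h - h'\<bar> \<le> d" and vv': "\<bar>v - v'\<bar> \<le> d"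
    and r: "0 < r" "r \<le> \<bar>h\<bar> \<or> r \<le> \<bar>v\<bar>"
  shows "difference_density h v \<le> difference_density h' v' + 756 * d / r\<^sup>2"
proof -
  define S where "S = (\<lambda>h c. cutoff (c + h / 2) * cutoff (c - h / 2))"
  define c where "c = v / (2 * h)"
  define c' where "c' = v' / (2 * h')"
  have le_mult1: "x * y \<le> \<bar>x\<bar>" if "0 \<le> y" "y \<le> 1" for x y :: real
    using that mult_mono[of x "\<bar>x\<bar>" y 1] mult_left_le[of y "\<bar>x\<bar>"]
    by (metis abs_ge_self abs_ge_zero mult_right_mono order_trans)
  have le_mult1': "y * x \<le> \<bar>x\<bar>" if "0 \<le> y" "y \<le> 1" for x y :: real
    using le_mult1[OF that] by (simp add: mult.commute)
  have d0: "0 \<le> d" using hh' by linarith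
  have err0: "0 \<le> 756 * d / r\<^sup>2" using d0 by simp
  have dd: "difference_density h v = S h c / (2 * \<bar>h\<bar>)" "difference_density h' v' = S h' c' / (2 * \<bar>h'\<bar>)"
    by (simp_all add: difference_density_def S_def c_def c'_def)
  have S: "0 \<le> S x y" "S x y \<le> 1" for x y
    unfolding S_def by (auto intro!: mult_nonneg_nonneg mult_le_one cutoff_bounds)
  show ?thesis
  proof (cases "h = 0 \<or> S h c = 0")
    case True
    then have "difference_density h v = 0" by (auto simp: dd)
    then show ?thesis using difference_density_nonneg[of h' v'] err0 by linarith
  next
    case False
    then have h0: "h \<noteq> 0" and S0: "S h c \<noteq> 0" by auto
    have "\<bar>c + h / 2\<bar> < 3" "\<bar>c - h / 2\<bar> < 3"
      using S0 cutoff_eq_0[of "c + h / 2"] cutoff_eq_0[of "c - h / 2"]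
      by (force simp: S_def not_le[symmetric])+
    then have c3: "\<bar>c\<bar> \<le> 3" and h6: "\<bar>h\<bar> \<le> 6" by linarith+
    have vc: "v = 2 * h * c" using h0 by (simp add: c_def)
    have v6: "\<bar>v\<bar> \<le> 6 * \<bar>h\<bar>"
      using mult_left_mono[OF c3, of "2 * \<bar>h\<bar>"] by (simp add: vc abs_mult)
    have rh: "r \<le> 6 * \<bar>h\<bar>" using r(2) v6 by linarith
    have "r\<^sup>2 \<le> (6 * \<bar>h\<bar>)\<^sup>2" using rh r by (intro power_mono) auto
    then have r2: "1 / h\<^sup>2 \<le> 36 / r\<^sup>2" using h0 r by (simp add: divide_simps power2_eq_square)
    \<comment> \<open>Since \<open>r \<le> 6 * \<bar>h\<bar>\<close>, a bound in terms of
      \<open>h\<close> suffices, and \<open>756 = 21 * 36\<close>.\<close>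
    have "difference_density h v \<le> difference_density h' v' + 21 * d / h\<^sup>2"
    \<comment> \<open>For a displacement comparable to \<open>\<bar>h\<bar>\<close> the size bound
      \<open>1 / (2 * \<bar>h\<bar>)\<close> is already below the error. Otherwise \<open>h'\<close>
      is comparable to \<open>h\<close>.\<close>
    proof (cases "d \<ge> \<bar>h\<bar> / 2")
      case True
      have "difference_density h v \<le> 1 / (2 * \<bar>h\<bar>)"
        unfolding dd using S by (intro divide_right_mono) auto
      also have "\<dots> = (\<bar>h\<bar> / 2) / h\<^sup>2" using h0 by (simp add: field_simps power2_eq_square abs_mult_self_eq)
      also have "\<dots> \<le> 21 * d / h\<^sup>2" using True d0 by (intro divide_right_mono) auto
      finally show ?thesis using difference_density_nonneg[of h' v'] by linarith
    next
      case False
      then have h': "\<bar>h'\<bar> \<ge> \<bar>h\<bar> / 2" using hh' by linarith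
      then have h'0: "h' \<noteq> 0" using h0 by auto
      have inv: "1 / \<bar>h'\<bar> \<le> 2 / \<bar>h\<bar>" using h' h0 h'0 by (simp add: field_simps)
      have "c - c' = (v - v') / (2 * h') + c * (h' - h) / h'"
        using h0 h'0 by (simp add: c_def c'_def field_simps)
      then have "\<bar>c - c'\<bar> \<le> \<bar>v - v'\<bar> * (1/2) * (1 / \<bar>h'\<bar>) + \<bar>c\<bar> * \<bar>h - h'\<bar> * (1 / \<bar>h'\<bar>)"
        using abs_triangle_ineq[of "(v - v') / (2 * h')" "c * (h' - h) / h'"]
        by (simp add: abs_mult abs_divide abs_minus_commute)
      also have "\<dots> \<le> d * (1/2) * (2 / \<bar>h\<bar>) + 3 * d * (2 / \<bar>h\<bar>)"
        using hh' vv' c3 d0 inv by (intro add_mono mult_mono) auto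
      also have "\<dots> = 7 * d / \<bar>h\<bar>" by (simp add: field_simps)
      finally have cc: "\<bar>c - c'\<bar> \<le> 7 * d / \<bar>h\<bar>" .
      \<comment> \<open>\<open>\<bar>h\<bar> \<le> 6\<close> brings this into the form of the bound
        on \<open>c - c'\<close>, so that the numerator changes by at most
        \<open>(2 * 7 + 6) * d / \<bar>h\<bar>\<close>.\<close>
      have hd: "\<bar>h - h'\<bar> \<le> 6 * d / \<bar>h\<bar>"
        using mult_mono[OF hh' h6 d0] h0 by (simp add: pos_le_divide_eq mult.commute)
      have "S h c - S h' c' = (cutoff (c + h/2) - cutoff (c' + h'/2)) * cutoff (c - h/2)
          + cutoff (c' + h'/2) * (cutoff (c - h/2) - cutoff (c' - h'/2))"
        by (simp add: S_def algebra_simps)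
      also have "\<dots> \<le> \<bar>cutoff (c + h/2) - cutoff (c' + h'/2)\<bar>
          + \<bar>cutoff (c - h/2) - cutoff (c' - h'/2)\<bar>"
        by (intro add_mono le_mult1 le_mult1') (auto simp: cutoff_bounds)
      finally have "S h c - S h' c' \<le> 2 * \<bar>c - c'\<bar> + \<bar>h - h'\<bar>"
        using cutoff_lipschitz[of "c + h/2" "c' + h'/2"] cutoff_lipschitz[of "c - h/2" "c' - h'/2"] by (auto simp: abs_if split: if_splits)
      moreover have "2 * (7 * d / \<bar>h\<bar>) + 6 * d / \<bar>h\<bar> = 20 * d / \<bar>h\<bar>"
        by (simp add: add_divide_distrib[symmetric])
      ultimately have SS: "S h c - S h' c' \<le> 20 * d / \<bar>h\<bar>" using cc hd by linarith
      \<comment> \<open>The change of the numerator costs \<open>20 * d / h\<^sup>2\<close>, that of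
        the denominator \<open>d / h\<^sup>2\<close>.\<close>
      have "S h c / (2 * \<bar>h\<bar>) - S h' c' / (2 * \<bar>h'\<bar>)
          = (S h c - S h' c') * (1 / (2 * \<bar>h'\<bar>)) + S h c * ((\<bar>h'\<bar> - \<bar>h\<bar>) / (2 * \<bar>h\<bar>) * (1 / \<bar>h'\<bar>))"
        using h0 h'0 by (simp add: field_simps)
      also have "\<dots> \<le> (20 * d / \<bar>h\<bar>) * (1 / \<bar>h\<bar>) + 1 * (d / (2 * \<bar>h\<bar>) * (2 / \<bar>h\<bar>))"
      proof (intro add_mono)
        have "(S h c - S h' c') * (1 / (2 * \<bar>h'\<bar>)) \<le> (20 * d / \<bar>h\<bar>) * (1 / (2 * \<bar>h'\<bar>))"
          using SS by (intro mult_right_mono) auto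
        also have "\<dots> \<le> (20 * d / \<bar>h\<bar>) * (1 / \<bar>h\<bar>)"
          using inv d0 by (intro mult_left_mono) auto
        finally show "(S h c - S h' c') * (1 / (2 * \<bar>h'\<bar>)) \<le> (20 * d / \<bar>h\<bar>) * (1 / \<bar>h\<bar>)" .
        have "\<bar>h'\<bar> - \<bar>h\<bar> \<le> d" using hh' by linarith
        then have "(\<bar>h'\<bar> - \<bar>h\<bar>) / (2 * \<bar>h\<bar>) * (1 / \<bar>h'\<bar>) \<le> d / (2 * \<bar>h\<bar>) * (1 / \<bar>h'\<bar>)"
          by (intro mult_right_mono divide_right_mono) auto
        also have "\<dots> \<le> d / (2 * \<bar>h\<bar>) * (2 / \<bar>h\<bar>)"
          using d0 inv by (intro mult_left_mono) auto
        finally have *: "(\<bar>h'\<bar> - \<bar>h\<bar>) / (2 * \<bar>h\<bar>) * (1 / \<bar>h'\<bar>) \<le> d / (2 * \<bar>h\<bar>) * (2 / \<bar>h\<bar>)" .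
        have "S h c * ((\<bar>h'\<bar> - \<bar>h\<bar>) / (2 * \<bar>h\<bar>) * (1 / \<bar>h'\<bar>)) \<le> S h c * (d / (2 * \<bar>h\<bar>) * (2 / \<bar>h\<bar>))"
          using * S by (intro mult_left_mono) auto
        also have "\<dots> \<le> 1 * (d / (2 * \<bar>h\<bar>) * (2 / \<bar>h\<bar>))"
          using S d0 by (intro mult_right_mono) auto
        finally show "S h c * ((\<bar>h'\<bar> - \<bar>h\<bar>) / (2 * \<bar>h\<bar>) * (1 / \<bar>h'\<bar>)) \<le> 1 * (d / (2 * \<bar>h\<bar>) * (2 / \<bar>h\<bar>))" .
      qed
      also have "\<dots> = 21 * d / h\<^sup>2" using h0 by (simp add: field_simps power2_eq_square)
      finally show ?thesis by (simp add: dd)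
    qed
    also have "21 * d / h\<^sup>2 \<le> 756 * d / r\<^sup>2"
      using mult_left_mono[OF r2, of "21 * d"] d0 by simp
    finally show ?thesis by simp
  qed
qed

section \<open>Translation estimate for the self-correlation averaged at scale
  \<open>d\<close>\<close>

definition correlation :: "real \<Rightarrow> real \<Rightarrow> real \<Rightarrow> ennreal" where
  "correlation d z1 z2 = (\<integral>\<^sup>+ a. \<integral>\<^sup>+ b. ennreal (cutoff a * cutoff b *
     (tent d (z1 + a - b) * tent d (z2 + a\<^sup>2 - b\<^sup>2))) \<partial>lborel \<partial>lborel)"

lemma difference_density_measurable [measurable (raw)]:
  assumes "f \<in> borel_measurable M" "g \<in> borel_measurable M"
  shows "(\<lambda>x. difference_density (f x) (g x)) \<in> borel_measurable M"
  unfolding difference_density_def using assms by measurable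

text \<open>Substitute \<open>h = a - b\<close> and then, for fixed \<open>h\<close>,
  \<open>r = z2 + 2 * h * b + h\<^sup>2\<close>, which is affine in \<open>b\<close>. The Jacobian
  \<open>1 / (2 * \<bar>h\<bar>)\<close> is the factor in \<open>difference_density\<close>. The
  correlation thus becomes an average of that density, and its regularity in \<open>(z1, z2)\<close>
  can be read off.\<close>

lemma correlation_eq:
  "correlation d z1 z2 = (\<integral>\<^sup>+ q. \<integral>\<^sup>+ r. ennreal (tent d q * tent d r *
     difference_density (q - z1) (r - z2)) \<partial>lborel \<partial>lborel)"
proof -
  have inner: "(\<integral>\<^sup>+ b. ennreal (cutoff (b + h) * cutoff b * (tent d (z1 + h) * tent d (z2 + (b + h)\<^sup>2 - b\<^sup>2))) \<partial>lborel)
      = (\<integral>\<^sup>+ r. ennreal (tent d (z1 + h) * tent d r * difference_density h (r - z2)) \<partial>lborel)" (is "?L = ?R")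
    if h: "h \<noteq> 0" for h
  proof -
    \<comment> \<open>\<open>?b r\<close> solves \<open>z2 + (b + h)\<^sup>2 - b\<^sup>2 = r\<close>
      for \<open>b\<close>.\<close>
    let ?b = "\<lambda>r. (- h / 2 - z2 / (2 * h)) + 1 / (2 * h) * r"
    have "?L = \<bar>1 / (2 * h)\<bar> * (\<integral>\<^sup>+ r. ennreal (cutoff (?b r + h) * cutoff (?b r) *
        (tent d (z1 + h) * tent d (z2 + (?b r + h)\<^sup>2 - (?b r)\<^sup>2))) \<partial>lborel)"
      by (rule nn_integral_real_affine) (use h in auto)
    also have "\<dots> = (\<integral>\<^sup>+ r. ennreal \<bar>1 / (2 * h)\<bar> * ennreal (cutoff (?b r + h) * cutoff (?b r) *
        (tent d (z1 + h) * tent d (z2 + (?b r + h)\<^sup>2 - (?b r)\<^sup>2))) \<partial>lborel)"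
      by (rule nn_integral_cmult[symmetric]) simp
    also have "\<dots> = ?R"
    proof (intro nn_integral_cong)
      fix r
      have 1: "?b r + h = (r - z2) / (2 * h) + h / 2" "?b r = (r - z2) / (2 * h) - h / 2"
        using h by (simp_all add: field_simps)
      have 2: "z2 + (?b r + h)\<^sup>2 - (?b r)\<^sup>2 = r"
        unfolding 1 using h by (simp add: power2_eq_square field_simps)
      show "ennreal \<bar>1 / (2 * h)\<bar> * ennreal (cutoff (?b r + h) * cutoff (?b r) *
        (tent d (z1 + h) * tent d (z2 + (?b r + h)\<^sup>2 - (?b r)\<^sup>2)))
        = ennreal (tent d (z1 + h) * tent d r * difference_density h (r - z2))"
        unfolding 2 unfolding 1 difference_density_def
        by (subst ennreal_mult'[symmetric]) (simp_all add: abs_divide abs_mult field_simps)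
    qed
    finally show ?thesis .
  qed
  have "correlation d z1 z2 = (\<integral>\<^sup>+ b. \<integral>\<^sup>+ a. ennreal (cutoff a * cutoff b *
     (tent d (z1 + a - b) * tent d (z2 + a\<^sup>2 - b\<^sup>2))) \<partial>lborel \<partial>lborel)"
    unfolding correlation_def by (rule lborel_pair.Fubini') simp
  also have "\<dots> = (\<integral>\<^sup>+ b. \<integral>\<^sup>+ h. ennreal (cutoff (b + h) * cutoff b *
     (tent d (z1 + h) * tent d (z2 + (b + h)\<^sup>2 - b\<^sup>2))) \<partial>lborel \<partial>lborel)"
    (is "_ = (\<integral>\<^sup>+ b. ?I b \<partial>_)")
  proof (rule nn_integral_cong)
    fix b :: real
    show "(\<integral>\<^sup>+ a. ennreal (cutoff a * cutoff b *
     (tent d (z1 + a - b) * tent d (z2 + a\<^sup>2 - b\<^sup>2))) \<partial>lborel) = ?I b"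
      by (subst nn_integral_real_affine[where c = 1 and t = b]) (simp_all add: add.commute add.left_commute)
  qed
  also have "\<dots> = (\<integral>\<^sup>+ h. \<integral>\<^sup>+ b. ennreal (cutoff (b + h) * cutoff b *
     (tent d (z1 + h) * tent d (z2 + (b + h)\<^sup>2 - b\<^sup>2))) \<partial>lborel \<partial>lborel)"
    by (rule lborel_pair.Fubini') simp
  also have "\<dots> = (\<integral>\<^sup>+ h. \<integral>\<^sup>+ r. ennreal (tent d (z1 + h) * tent d r * difference_density h (r - z2)) \<partial>lborel \<partial>lborel)"
    using AE_lborel_singleton[of "0::real"] by (intro nn_integral_cong_AE) (auto intro: inner)
  also have "\<dots> = (\<integral>\<^sup>+ q. \<integral>\<^sup>+ r. ennreal (tent d q * tent d r * difference_density (q - z1) (r - z2)) \<partial>lborel \<partial>lborel)"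
    by (subst nn_integral_real_affine[where c = 1 and t = "- z1"]) (simp_all add: algebra_simps)
  finally show ?thesis .
qed

lemma tent_le: "0 \<le> d \<Longrightarrow> ennreal (tent d (x - b)) \<le> ennreal d * indicator {x - d..x + d} b"
  by (auto simp: tent_def indicator_def max_def intro!: ennreal_leI)

lemma nn_integral_tent_le:
  assumes "0 < d" shows "(\<integral>\<^sup>+ b. ennreal (tent d (x - b)) \<partial>lborel) \<le> ennreal (2 * d\<^sup>2)"
proof -
  have "(\<integral>\<^sup>+ b. ennreal (tent d (x - b)) \<partial>lborel) \<le> (\<integral>\<^sup>+ b. ennreal d * indicator {x - d..x + d} b \<partial>lborel)"
    using assms by (intro nn_integral_mono tent_le) auto
  also have "\<dots> = ennreal (2 * d\<^sup>2)"
    using assms by (simp add: nn_integral_cmult_indicator ennreal_mult'[symmetric] power2_eq_square)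
  finally show ?thesis .
qed

text \<open>One tent is at most \<open>d\<close>, the other integrates over \<open>b\<close> to at
  most \<open>2 * d\<^sup>2\<close>, and \<open>a\<close> ranges over an interval of length
  6.\<close>

lemma correlation_near:
  assumes "0 < d"
  shows "correlation d z1 z2 \<le> ennreal (12 * d ^ 3)"
proof -
  have "correlation d z1 z2 \<le> (\<integral>\<^sup>+ a. \<integral>\<^sup>+ b. ennreal d * indicator {-3..3::real} a * ennreal (tent d (z1 + a - b)) \<partial>lborel \<partial>lborel)"
    unfolding correlation_def
  proof (intro nn_integral_mono)
    fix a b :: real
    have "cutoff a * cutoff b * (tent d (z1 + a - b) * tent d (z2 + a\<^sup>2 - b\<^sup>2))
        \<le> indicator {-3..3::real} a * 1 * (tent d (z1 + a - b) * d)"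
      using assms by (intro mult_mono mult_nonneg_nonneg cutoff_bounds tent_nonneg)
        (auto simp: cutoff_def tent_def indicator_def)
    then show "ennreal (cutoff a * cutoff b * (tent d (z1 + a - b) * tent d (z2 + a\<^sup>2 - b\<^sup>2)))
        \<le> ennreal d * indicator {-3..3::real} a * ennreal (tent d (z1 + a - b))"
      using assms by (auto simp: indicator_def ennreal_mult'[symmetric] mult.commute tent_nonneg ennreal_neg intro!: ennreal_leI split: if_splits)
  qed
  also have "\<dots> \<le> (\<integral>\<^sup>+ a. ennreal d * indicator {-3..3::real} a * ennreal (2 * d\<^sup>2) \<partial>lborel)"
    using assms by (subst nn_integral_cmult) (auto intro!: nn_integral_mono mult_left_mono nn_integral_tent_le)
  also have "\<dots> = ennreal (12 * d ^ 3)"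
    using assms by (simp add: mult.assoc nn_integral_cmult nn_integral_multc ennreal_mult'[symmetric] ennreal_numeral[symmetric] power2_eq_square power3_eq_cube del: ennreal_numeral)
  finally show ?thesis .
qed

text \<open>The tents confine \<open>q\<close> and \<open>r\<close> to absolute value below
  \<open>d \<le> n / 2\<close>, so the density is evaluated where some coordinate is at least
  \<open>n / 2\<close> and \<open>difference_density_lipschitz\<close> applies. Integrating its
  error against both tents costs a factor of at most \<open>4 * d ^ 4\<close>.\<close>

lemma correlation_far:
  assumes d: "0 < d" and e: "\<bar>e1\<bar> \<le> d" "\<bar>e2\<bar> \<le> d"
    and n: "2 * d \<le> n" "n \<le> \<bar>z1\<bar> \<or> n \<le> \<bar>z2\<bar>"
  shows "correlation d z1 z2 \<le> correlation d (z1 + e1) (z2 + e2) + ennreal (12096 * d ^ 5 / n\<^sup>2)"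
proof -
  define c where "c = 756 * d / (n / 2)\<^sup>2"
  have n0: "n > 0" using d n by linarith
  have c0: "c \<ge> 0" using d by (simp add: c_def)
  have "correlation d z1 z2 \<le> (\<integral>\<^sup>+ q. \<integral>\<^sup>+ r. ennreal (tent d q * tent d r * difference_density (q - (z1 + e1)) (r - (z2 + e2)))
      + ennreal c * (ennreal (tent d q) * ennreal (tent d r)) \<partial>lborel \<partial>lborel)"
    unfolding correlation_eq
  proof (intro nn_integral_mono)
    fix q r
    have "tent d q * tent d r * difference_density (q - z1) (r - z2)
        \<le> tent d q * tent d r * difference_density (q - (z1 + e1)) (r - (z2 + e2)) + c * (tent d q * tent d r)"
    proof (cases "\<bar>q\<bar> < d \<and> \<bar>r\<bar> < d")
      case True
      have "difference_density (q - z1) (r - z2) \<le> difference_density (q - (z1 + e1)) (r - (z2 + e2)) + c"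
        unfolding c_def
      proof (rule difference_density_lipschitz)
        show "n / 2 \<le> \<bar>q - z1\<bar> \<or> n / 2 \<le> \<bar>r - z2\<bar>"
          using True n d by linarith
      qed (use e n0 in auto)
      from mult_left_mono[OF this, of "tent d q * tent d r"] show ?thesis
        by (simp add: tent_nonneg algebra_simps)
    next
      case False
      then have "tent d q * tent d r = 0" by (auto simp: tent_def)
      then show ?thesis by auto
    qed
    then show "ennreal (tent d q * tent d r * difference_density (q - z1) (r - z2))
       \<le> ennreal (tent d q * tent d r * difference_density (q - (z1 + e1)) (r - (z2 + e2)))
      + ennreal c * (ennreal (tent d q) * ennreal (tent d r))"
      using c0 by (simp add: ennreal_mult[symmetric] ennreal_plus[symmetric] ennreal_leI tent_nonneg difference_density_nonneg
          del: ennreal_plus)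
  qed
  also have "\<dots> = correlation d (z1 + e1) (z2 + e2)
      + ennreal c * ((\<integral>\<^sup>+ q. ennreal (tent d q) \<partial>lborel) * (\<integral>\<^sup>+ r. ennreal (tent d r) \<partial>lborel))"
    unfolding correlation_eq by (simp add: nn_integral_add nn_integral_cmult nn_integral_multc)
  also have "\<dots> \<le> correlation d (z1 + e1) (z2 + e2) + ennreal c * (ennreal (2 * d\<^sup>2) * ennreal (2 * d\<^sup>2))"
    using nn_integral_tent_le[OF d, of 0] by (intro add_mono mult_mono order_refl) (auto simp: tent_def)
  also have "ennreal c * (ennreal (2 * d\<^sup>2) * ennreal (2 * d\<^sup>2)) = ennreal (12096 * d ^ 5 / n\<^sup>2)"
    using n0 d by (simp add: c_def ennreal_mult'[symmetric]) (simp add: field_simps power2_eq_square eval_nat_numeral)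
  finally show ?thesis .
qed

text \<open>Interpolation of the two preceding bounds. For \<open>N \<le> 4 * d\<close> the ratio
  \<open>d / N\<close> is bounded below and the size bound is enough; beyond that the quadratic
  decay \<open>(d / N)\<^sup>2\<close> is weakened to \<open>(d / N) powr t\<close>. The exponent
  \<open>t\<close> makes the error a multiple of the Riesz kernel when \<open>N\<close> is the
  distance of two points.\<close>

lemma correlation_shift:
  assumes d: "0 < d" and e: "\<bar>e1\<bar> \<le> d" "\<bar>e2\<bar> \<le> d" and t: "0 \<le> t" "t \<le> 2"
    and N: "0 < N" "N \<le> 2 * \<bar>z1\<bar> \<or> N \<le> 2 * \<bar>z2\<bar>"
  shows "correlation d z1 z2 \<le> correlation d (z1 + e1) (z2 + e2) + ennreal (48384 * d ^ 3 * (d / N) powr t)"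
proof (cases "N \<le> 4 * d")
  case True
  have "1 / 16 = (1/4) powr (2::real)" by (simp add: power2_eq_square)
  also have "\<dots> \<le> (1/4::real) powr t" using t by (intro powr_mono') auto
  also have "\<dots> \<le> (d / N) powr t" using True N d t by (intro powr_mono2) (auto simp: field_simps)
  finally have "12 * d ^ 3 \<le> 48384 * d ^ 3 * (d / N) powr t" using d by simp
  then have "correlation d z1 z2 \<le> ennreal (48384 * d ^ 3 * (d / N) powr t)"
    using correlation_near[OF d, of z1 z2] by (meson ennreal_leI order_trans)
  then show ?thesis by (meson add_increasing zero_le)
next
  case False
  have "(d / N)\<^sup>2 = (d / N) powr 2" using d N by simp
  also have "\<dots> \<le> (d / N) powr t" using False N d t by (intro powr_mono') (auto simp: field_simps)
  finally have *: "(d / N)\<^sup>2 \<le> (d / N) powr t" .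
  have "12096 * d ^ 5 / (N / 2)\<^sup>2 = 48384 * d ^ 3 * (d / N)\<^sup>2"
    using N by (simp add: field_simps eval_nat_numeral)
  also have "\<dots> \<le> 48384 * d ^ 3 * (d / N) powr t" using * d by (intro mult_left_mono) auto
  finally have "ennreal (12096 * d ^ 5 / (N / 2)\<^sup>2) \<le> ennreal (48384 * d ^ 3 * (d / N) powr t)" by (rule ennreal_leI)
  moreover have "correlation d z1 z2 \<le> correlation d (z1 + e1) (z2 + e2) + ennreal (12096 * d ^ 5 / (N / 2)\<^sup>2)"
    using False N by (intro correlation_far d e) auto
  ultimately show ?thesis by (meson add_left_mono order_trans)
qed

subsection \<open>Pairings of measures on squares\<close>

definition square :: "real \<Rightarrow> real \<times> real \<Rightarrow> (real^2) set" where
  "square d w = {x. fst w \<le> x$1 \<and> x$1 < fst w + d \<and> snd w \<le> x$2 \<and> x$2 < snd w + d}"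

lemma fst_snd_borel_measurable [measurable]:
  "fst \<in> borel_measurable (borel :: (real \<times> real) measure)"
  "snd \<in> borel_measurable (borel :: (real \<times> real) measure)"
  unfolding borel_prod[symmetric] by measurable

lemma vec_nth_borel_measurable [measurable (raw)]:
  fixes f :: "'a \<Rightarrow> real^'n"
  assumes "f \<in> borel_measurable M"
  shows "(\<lambda>x. f x $ i) \<in> borel_measurable M"
  using assms by (rule measurable_compose) (rule borel_measurable_nth)

lemma indicator_square: "indicator (square d w) x = (indicator {0..<d} (x$1 - fst w) * indicator {0..<d} (x$2 - snd w) :: ennreal)"
  by (auto simp: square_def indicator_def)

lemma square_sets [measurable]: "square d w \<in> sets borel"
  unfolding square_def by measurable

lemma nn_integral_indicator_tent:
  "(\<integral>\<^sup>+ w. indicator {0..<d} (p - w) * indicator {0..<d} (q - w) \<partial>lborel) = ennreal (tent d (p - q))"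
proof -
  have "(\<integral>\<^sup>+ w. indicator {0..<d} (p - w) * indicator {0..<d} (q - w) \<partial>lborel)
      = (\<integral>\<^sup>+ w. indicator {max p q - d<..min p q} w \<partial>lborel)"
    by (intro nn_integral_cong) (auto simp: indicator_def max_def min_def)
  also have "\<dots> = ennreal (tent d (p - q))"
    by (auto simp: tent_def max_def min_def abs_if ennreal_neg)
  finally show ?thesis .
qed

text \<open>The L2 inner product of the square masses of \<open>M\<close> with those of
  \<open>N\<close> displaced by \<open>e\<close>, the integral over positions being already carried
  out. In the outline, \<open>A(d)\<close> is \<open>pairing d 0 \<nu> \<nu>\<close> and
  \<open>E(d)\<close> is \<open>pairing d 0 \<nu> m\<close>.\<close>

definition pairing :: "real \<Rightarrow> real \<times> real \<Rightarrow> (real^2) measure \<Rightarrow> (real^2) measure \<Rightarrow> ennreal" where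
  "pairing d e M N = (\<integral>\<^sup>+ u. \<integral>\<^sup>+ v. ennreal (tent d (u$1 - v$1 + fst e) * tent d (u$2 - v$2 + snd e)) \<partial>N \<partial>M)"

locale two_measures = M: finite_measure M + N: finite_measure N
  for M N :: "(real^2) measure" +
  assumes sets_M [measurable_cong, simp]: "sets M = sets borel"
    and sets_N [measurable_cong, simp]: "sets N = sets borel"
begin

text \<open>Tonelli, followed by the product structure: in each coordinate the positions whose two
  intervals catch the two given points form an interval of length given by
  \<open>tent\<close>.\<close>

lemma nn_integral_squares:
  "(\<integral>\<^sup>+ w. emeasure M (square d (w + a)) * emeasure N (square d (w + b)) \<partial>lborel) = pairing d (b - a) M N"
proof -
  let ?i = "indicator {0..<d} :: real \<Rightarrow> ennreal"
  let ?K = "\<lambda>w a (u::real^2). ?i (u$1 - fst (w + a)) * ?i (u$2 - snd (w + a))"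
  interpret LM: pair_sigma_finite "lborel :: (real \<times> real) measure" M ..
  interpret LN: pair_sigma_finite "lborel :: (real \<times> real) measure" N ..
  have "(\<integral>\<^sup>+ w. emeasure M (square d (w + a)) * emeasure N (square d (w + b)) \<partial>lborel)
      = (\<integral>\<^sup>+ w. (\<integral>\<^sup>+ u. ?K w a u \<partial>M) * (\<integral>\<^sup>+ v. ?K w b v \<partial>N) \<partial>lborel)"
    by (simp add: indicator_square[symmetric] del: fst_add snd_add)
  also have "\<dots> = (\<integral>\<^sup>+ w. \<integral>\<^sup>+ u. \<integral>\<^sup>+ v. ?K w a u * ?K w b v \<partial>N \<partial>M \<partial>lborel)"
    by (simp add: nn_integral_cmult nn_integral_multc)
  also have "\<dots> = (\<integral>\<^sup>+ u. \<integral>\<^sup>+ w. \<integral>\<^sup>+ v. ?K w a u * ?K w b v \<partial>N \<partial>lborel \<partial>M)"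
    by (rule LM.Fubini'[symmetric]) (simp add: split_beta')
  also have "\<dots> = (\<integral>\<^sup>+ u. \<integral>\<^sup>+ v. \<integral>\<^sup>+ w. ?K w a u * ?K w b v \<partial>lborel \<partial>N \<partial>M)"
    by (intro nn_integral_cong LN.Fubini'[symmetric]) (simp add: split_beta')
  also have "\<dots> = pairing d (b - a) M N"
    unfolding pairing_def
  proof (intro nn_integral_cong)
    fix u v :: "real^2"
    have "(\<integral>\<^sup>+ w. ?K w a u * ?K w b v \<partial>lborel)
        = (\<integral>\<^sup>+ w. (?i ((u$1 - fst a) - fst w) * ?i ((v$1 - fst b) - fst w)) * (?i ((u$2 - snd a) - snd w) * ?i ((v$2 - snd b) - snd w)) \<partial>(lborel \<Otimes>\<^sub>M lborel))"
      by (simp add: lborel_prod algebra_simps)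
    also have "\<dots> = (\<integral>\<^sup>+ x. (?i ((u$1 - fst a) - x) * ?i ((v$1 - fst b) - x)) * (\<integral>\<^sup>+ y. (?i ((u$2 - snd a) - y) * ?i ((v$2 - snd b) - y)) \<partial>lborel) \<partial>lborel)"
      by (subst lborel.nn_integral_fst[symmetric]) (simp_all add: nn_integral_cmult)
    also have "\<dots> = ennreal (tent d ((u$1 - fst a) - (v$1 - fst b))) * ennreal (tent d ((u$2 - snd a) - (v$2 - snd b)))"
      by (simp add: nn_integral_multc nn_integral_indicator_tent)
    also have "\<dots> = ennreal (tent d (u$1 - v$1 + fst (b - a)) * tent d (u$2 - v$2 + snd (b - a)))"
      by (simp add: ennreal_mult tent_nonneg algebra_simps)
    finally show "(\<integral>\<^sup>+ w. ?K w a u * ?K w b v \<partial>lborel) = ennreal (tent d (u$1 - v$1 + fst (b - a)) * tent d (u$2 - v$2 + snd (b - a)))" .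
  qed
  finally show ?thesis .
qed

lemma pairing_le:
  assumes "0 < d"
  shows "pairing d e M N \<le> ennreal (d\<^sup>2) * (emeasure M UNIV * emeasure N UNIV)"
proof -
  have "pairing d e M N \<le> (\<integral>\<^sup>+ u. \<integral>\<^sup>+ v. ennreal (d\<^sup>2) \<partial>N \<partial>M)"
    unfolding pairing_def power2_eq_square using assms
    by (intro nn_integral_mono ennreal_leI mult_mono) (auto simp: tent_def)
  also have "\<dots> = ennreal (d\<^sup>2) * (emeasure M UNIV * emeasure N UNIV)"
    using sets_eq_imp_space_eq[OF sets_M] sets_eq_imp_space_eq[OF sets_N] by (simp add: ac_simps)
  finally show ?thesis .
qed

lemma pairing_finite:
  assumes "0 < d" shows "pairing d e M N < \<infinity>"
proof -
  have "ennreal (d\<^sup>2) * (emeasure M UNIV * emeasure N UNIV) < \<infinity>"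
    by (simp add: ennreal_mult_less_top M.emeasure_finite N.emeasure_finite less_top[symmetric] ennreal_mult_eq_top_iff)
  then show ?thesis using pairing_le[OF assms, of e] by order
qed

end

text \<open>An interval of length \<open>2 * d\<close> is two of length \<open>d\<close> side by
  side, whose pairwise displacements \<open>-d, 0, d\<close> occur 1, 2, 1 times.\<close>

lemma tent_double:
  assumes "0 < d"
  shows "tent (2 * d) z = (\<Sum>i\<in>{-1, 0, 1}. (2 - \<bar>i\<bar>) * tent d (z + i * d))"
  using assms by (simp add: tent_def max_def abs_if)

lemma emeasure_square_measurable:
  assumes "finite_measure N" and [measurable_cong]: "sets N = sets borel"
  shows "(\<lambda>w. emeasure N (square d (w + a))) \<in> borel_measurable borel"
proof -
  interpret finite_measure N by fact
  have "(\<lambda>w. emeasure N (square d (w + a))) = (\<lambda>w. \<integral>\<^sup>+ u. indicator {0..<d} (u$1 - fst (w + a)) * indicator {0..<d} (u$2 - snd (w + a)) \<partial>N)"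
    using assms by (simp add: indicator_square[symmetric] del: fst_add snd_add)
  then show ?thesis by simp
qed

lemma measure_square_measurable:
  assumes "finite_measure N" and "sets N = sets borel"
  shows "(\<lambda>w. measure N (square d (w + a))) \<in> borel_measurable borel"
  unfolding measure_def using emeasure_square_measurable[OF assms] by measurable

text \<open>
  The squared $L^2$ norm of the difference of the square averages of \<open>N\<close> and of their translate by \<open>e\<close>.
  This is where cancellation enters.
\<close>
definition roughness :: "real \<Rightarrow> real \<times> real \<Rightarrow> (real^2) measure \<Rightarrow> ennreal" where
  "roughness d e N = (\<integral>\<^sup>+ w. ennreal ((measure N (square d w) - measure N (square d (w + e)))\<^sup>2) \<partial>lborel)"

text \<open>Expand the square; by translation invariance both square terms integrate to
  \<open>pairing d 0 N N\<close>. The cross term stands on the left because subtraction of extended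
  nonnegative reals is truncated.\<close>

lemma roughness_eq:
  assumes "finite_measure N" and "sets N = sets borel"
  shows "roughness d e N + 2 * pairing d e N N = 2 * pairing d 0 N N"
proof -
  interpret finite_measure N by fact
  interpret two_measures N N using assms by unfold_locales auto
  note [measurable] = measure_square_measurable[OF assms] measure_square_measurable[OF assms, of d 0, simplified]
  let ?f = "\<lambda>w. measure N (square d w)" and ?g = "\<lambda>w. measure N (square d (w + e))"
  have "roughness d e N + 2 * pairing d e N N
      = (\<integral>\<^sup>+ w. ennreal ((?f w - ?g w)\<^sup>2) + 2 * (ennreal (?f w) * ennreal (?g w)) \<partial>lborel)"
    using nn_integral_squares[of d 0 e]
    by (simp add: roughness_def nn_integral_add nn_integral_cmult emeasure_eq_measure)
  also have "\<dots> = (\<integral>\<^sup>+ w. ennreal (?f w) * ennreal (?f w) + ennreal (?g w) * ennreal (?g w) \<partial>lborel)"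
  proof (intro nn_integral_cong)
    fix w
    have "ennreal ((?f w - ?g w)\<^sup>2) + 2 * (ennreal (?f w) * ennreal (?g w)) = ennreal ((?f w - ?g w)\<^sup>2 + 2 * (?f w * ?g w))"
      by (simp add: ennreal_mult ennreal_plus)
    also have "\<dots> = ennreal (?f w * ?f w + ?g w * ?g w)"
      by (rule arg_cong[where f = ennreal]) (simp add: power2_eq_square algebra_simps)
    also have "\<dots> = ennreal (?f w) * ennreal (?f w) + ennreal (?g w) * ennreal (?g w)"
      by (simp add: ennreal_mult ennreal_plus)
    finally show "ennreal ((?f w - ?g w)\<^sup>2) + 2 * (ennreal (?f w) * ennreal (?g w)) = ennreal (?f w) * ennreal (?f w) + ennreal (?g w) * ennreal (?g w)" .
  qed
  also have "\<dots> = 2 * pairing d 0 N N"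
    using nn_integral_squares[of d 0 0] nn_integral_squares[of d e e]
    by (simp add: nn_integral_add emeasure_eq_measure mult_2)
  finally show ?thesis .
qed

context two_measures
begin

text \<open>Cauchy-Schwarz in the form
  \<open>x * y \<le> l * x\<^sup>2 + y\<^sup>2 / (4 * l)\<close>, for the mass of \<open>M\<close>
  and the difference of the masses of \<open>N\<close>. The parameter \<open>l\<close> stays free so
  that it can be tuned to each scale.\<close>

lemma pairing_shift:
  assumes l: "0 < l"
  shows "pairing d 0 M N \<le> pairing d e M N + (ennreal l * pairing d 0 M M + ennreal (1 / (4 * l)) * roughness d e N)"
proof -
  interpret MM: two_measures M M by unfold_locales auto
  define k where "k = 1 / (4 * l)"
  have k: "0 < k" "k * (4 * l) = 1" using l by (simp_all add: k_def)
  note [measurable] = measure_square_measurable[OF N.finite_measure_axioms sets_N] measure_square_measurable[OF N.finite_measure_axioms sets_N, of d 0, simplified]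
    measure_square_measurable[OF M.finite_measure_axioms sets_M, of d 0, simplified]
  let ?h = "\<lambda>w. measure M (square d w)" and ?f = "\<lambda>w. measure N (square d w)" and ?g = "\<lambda>w. measure N (square d (w + e))"
  have "pairing d 0 M N = (\<integral>\<^sup>+ w. ennreal (?h w) * ennreal (?f w) \<partial>lborel)"
    using nn_integral_squares[of d 0 0] by (simp add: M.emeasure_eq_measure N.emeasure_eq_measure)
  also have "\<dots> \<le> (\<integral>\<^sup>+ w. ennreal (?h w) * ennreal (?g w) + (ennreal l * (ennreal (?h w) * ennreal (?h w))
      + ennreal k * ennreal ((?f w - ?g w)\<^sup>2)) \<partial>lborel)"
  proof (intro nn_integral_mono)
    fix w
    have "0 \<le> (2 * l * ?h w - (?f w - ?g w))\<^sup>2 * k" using k by simp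
    also have "\<dots> = ?h w * ?g w + (l * (?h w * ?h w) + k * (?f w - ?g w)\<^sup>2) - ?h w * ?f w"
      using k(2) by algebra
    finally have "ennreal (?h w * ?f w) \<le> ennreal (?h w * ?g w + (l * (?h w * ?h w) + k * (?f w - ?g w)\<^sup>2))"
      by (intro ennreal_leI) simp
    then show "ennreal (?h w) * ennreal (?f w) \<le> ennreal (?h w) * ennreal (?g w) + (ennreal l * (ennreal (?h w) * ennreal (?h w))
      + ennreal k * ennreal ((?f w - ?g w)\<^sup>2))"
      using l k by (simp add: ennreal_mult ennreal_plus)
  qed
  also have "\<dots> = pairing d e M N + (ennreal l * pairing d 0 M M + ennreal k * roughness d e N)"
    using nn_integral_squares[of d 0 e] MM.nn_integral_squares[of d 0 0]
    by (simp add: nn_integral_add nn_integral_cmult roughness_def M.emeasure_eq_measure N.emeasure_eq_measure)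
  finally show ?thesis unfolding k_def .
qed

definition stencil :: "(real \<times> real) set" where
  "stencil = {-1, 0, 1} \<times> {-1, 0, 1}"

text \<open>The number of ordered pairs among the four subsquares of a square whose displacement is
  \<open>p\<close>, in units of their side; the total is \<open>4 * 4 = 16\<close>.\<close>

definition stencil_weight :: "real \<times> real \<Rightarrow> real" where
  "stencil_weight p = (2 - \<bar>fst p\<bar>) * (2 - \<bar>snd p\<bar>)"

lemma stencil_weight_nonneg: "p \<in> stencil \<Longrightarrow> 0 \<le> stencil_weight p"
  by (auto simp: stencil_def stencil_weight_def)

lemma sum_stencil_weight: "(\<Sum>p\<in>stencil. ennreal (stencil_weight p)) = 16"
proof -
  have "(\<Sum>p\<in>stencil. stencil_weight p) = 16"
    by (simp add: stencil_def stencil_weight_def sum.cartesian_product[symmetric] split_beta')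
  then show ?thesis by (simp add: sum_ennreal stencil_weight_nonneg)
qed

lemma pairing_double_eq:
  assumes "0 < d"
  shows "pairing (2 * d) 0 M N = (\<Sum>p\<in>stencil. ennreal (stencil_weight p) * pairing d (d *\<^sub>R p) M N)"
proof -
  have *: "ennreal (tent (2 * d) x * tent (2 * d) y)
      = (\<Sum>p\<in>stencil. ennreal (stencil_weight p) * ennreal (tent d (x + d * fst p) * tent d (y + d * snd p)))" for x y
  proof -
    have "tent (2 * d) x * tent (2 * d) y
      = (\<Sum>p\<in>stencil. stencil_weight p * (tent d (x + d * fst p) * tent d (y + d * snd p)))"
      unfolding tent_double[OF assms] sum_product sum.cartesian_product stencil_def stencil_weight_def
      by (intro sum.cong refl) (auto simp: ac_simps)
    also have "ennreal \<dots> = (\<Sum>p\<in>stencil. ennreal (stencil_weight p * (tent d (x + d * fst p) * tent d (y + d * snd p))))"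
      by (simp add: sum_ennreal stencil_weight_nonneg tent_nonneg)
    also have "\<dots> = (\<Sum>p\<in>stencil. ennreal (stencil_weight p) * ennreal (tent d (x + d * fst p) * tent d (y + d * snd p)))"
      by (intro sum.cong refl ennreal_mult mult_nonneg_nonneg tent_nonneg stencil_weight_nonneg)
    finally show ?thesis .
  qed
  show ?thesis
    unfolding pairing_def by (simp add: * nn_integral_sum nn_integral_cmult)
qed

text \<open>Each of the nine displaced pairings is compared with the undisplaced one by
  \<open>pairing_shift\<close>. All displacements are at most \<open>d\<close> in each coordinate,
  and the weights add up to 16 on the pairing and on the error alike.\<close>

lemma pairing_double:
  assumes d: "0 < d" and l: "0 < l" and R: "0 \<le> R"
    and rough: "\<And>e. \<bar>fst e\<bar> \<le> d \<Longrightarrow> \<bar>snd e\<bar> \<le> d \<Longrightarrow> roughness d e N \<le> ennreal R"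
  shows "16 * pairing d 0 M N \<le> pairing (2 * d) 0 M N + 16 * (ennreal l * pairing d 0 M M + ennreal (R / (4 * l)))"
proof -
  let ?B = "ennreal l * pairing d 0 M M + ennreal (R / (4 * l))"
  have step: "pairing d 0 M N \<le> pairing d (d *\<^sub>R p) M N + ?B" if "p \<in> stencil" for p
  proof -
    have "ennreal (1 / (4 * l)) * roughness d (d *\<^sub>R p) N \<le> ennreal (1 / (4 * l)) * ennreal R"
      using that d by (intro mult_left_mono rough) (auto simp: stencil_def)
    also have "\<dots> = ennreal (R / (4 * l))" using l R by (simp add: ennreal_mult'[symmetric])
    finally show ?thesis
      by (intro order_trans[OF pairing_shift[OF l, of d "d *\<^sub>R p"]] add_left_mono)
  qed
  have "16 * pairing d 0 M N = (\<Sum>p\<in>stencil. ennreal (stencil_weight p) * pairing d 0 M N)"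
    unfolding sum_stencil_weight[symmetric] by (rule sum_distrib_right)
  also have "\<dots> \<le> (\<Sum>p\<in>stencil. ennreal (stencil_weight p) * (pairing d (d *\<^sub>R p) M N + ?B))"
    by (intro sum_mono mult_left_mono step) auto
  also have "\<dots> = pairing (2 * d) 0 M N + (\<Sum>p\<in>stencil. ennreal (stencil_weight p)) * ?B"
    unfolding pairing_double_eq[OF d] sum_distrib_right sum.distrib[symmetric]
    by (intro sum.cong refl distrib_left)
  finally show ?thesis unfolding sum_stencil_weight .
qed

end

subsection \<open>Convolution with measures on the parabola\<close>

definition parabola_point :: "real \<Rightarrow> real^2" where
  "parabola_point a = a *\<^sub>R axis 1 1 + a\<^sup>2 *\<^sub>R axis 2 1"

lemma parabola_point_nth [simp]: "parabola_point a $ 1 = a" "parabola_point a $ 2 = a\<^sup>2"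
  by (simp_all add: parabola_point_def axis_def)

lemma parabola_point_measurable [measurable]: "parabola_point \<in> borel_measurable borel"
  unfolding parabola_point_def by measurable

lemma parabola_eq: "parabola = parabola_point ` {-1..1}"
proof -
  have "vector [x, x\<^sup>2] = parabola_point x" for x
    by (simp add: vec_eq_iff forall_2)
  then show ?thesis by (auto simp: parabola_def)
qed

definition smooth_parabola :: "(real^2) measure" where
  "smooth_parabola = distr (density lborel (\<lambda>a. ennreal (cutoff a))) borel parabola_point"

lemma sets_smooth_parabola [measurable_cong, simp]: "sets smooth_parabola = sets borel"
  by (simp add: smooth_parabola_def)

lemma space_smooth_parabola [simp]: "space smooth_parabola = UNIV"
  by (simp add: smooth_parabola_def)

lemma nn_integral_smooth_parabola:
  assumes [measurable]: "f \<in> borel_measurable borel"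
  shows "(\<integral>\<^sup>+ x. f x \<partial>smooth_parabola) = (\<integral>\<^sup>+ a. ennreal (cutoff a) * f (parabola_point a) \<partial>lborel)"
  unfolding smooth_parabola_def by (simp add: nn_integral_distr nn_integral_density)

lemma emeasure_smooth_parabola_le: "emeasure smooth_parabola UNIV \<le> 6"
proof -
  have "emeasure smooth_parabola UNIV = (\<integral>\<^sup>+ a. ennreal (cutoff a) \<partial>lborel)"
    using nn_integral_smooth_parabola[of "\<lambda>x. indicator UNIV x"] by simp
  also have "\<dots> \<le> (\<integral>\<^sup>+ a. indicator {-3..3::real} a \<partial>lborel)"
    by (intro nn_integral_mono) (auto simp: indicator_def cutoff_def ennreal_neg)
  finally show ?thesis by simp
qed

lemma finite_measure_smooth_parabola: "finite_measure smooth_parabola"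
  using emeasure_smooth_parabola_le
  by (intro finite_measureI) (simp add: smooth_parabola_def, metis ennreal_numeral ennreal_less_top leD top.not_eq_extremum)

lemma dist_le_coords: "dist x y \<le> \<bar>x$1 - y$1\<bar> + \<bar>x$2 - y$2\<bar>" for x y :: "real^2"
  using norm_le_l1_cart[of "x - y"] by (simp add: dist_norm UNIV_2)

definition frostman :: "real \<Rightarrow> (real^2) measure \<Rightarrow> bool" where
  "frostman s \<sigma> \<longleftrightarrow> (\<forall>x. \<forall>r>0. emeasure \<sigma> (cball x r) \<le> ennreal (r powr s))"

text \<open>
  If the square meets the parabola, then the enlarged square on the right contains an arc of length
  about \<open>d\<close>.
\<close>
lemma frostman_square_le:
  assumes on: "borel_measure_on parabola \<sigma>" and fr: "frostman s \<sigma>"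
    and s: "0 \<le> s" "s \<le> 1" and d: "0 < d" "d \<le> 1"
  shows "emeasure \<sigma> (square d u) \<le> ennreal (4 * d powr (s - 1)) * emeasure smooth_parabola (square (4 * d) (u - (d, d)))"
proof (cases "\<exists>a\<in>{-1..1}. parabola_point a \<in> square d u")
  case False
  have [simp]: "sets \<sigma> = sets borel" and AE: "AE x in \<sigma>. x \<in> parabola"
    using on by (auto simp: borel_measure_on_def)
  have "AE x in \<sigma>. x \<notin> square d u"
    using AE by eventually_elim (use False in \<open>auto simp: parabola_eq\<close>)
  then have "emeasure \<sigma> (square d u) = 0"
    by (subst (asm) AE_iff_measurable[where N = "square d u"]) (auto simp: sets_eq_imp_space_eq[of \<sigma> borel])
  then show ?thesis by simp
next
  case True
  then obtain a where a: "\<bar>a\<bar> \<le> 1" "parabola_point a \<in> square d u" by (auto simp: abs_le_iff)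
  have [simp]: "sets \<sigma> = sets borel" using on by (auto simp: borel_measure_on_def)
  have "square d u \<subseteq> cball (parabola_point a) (2 * d)"
  proof
    fix x assume "x \<in> square d u"
    then have "\<bar>x$1 - parabola_point a$1\<bar> \<le> d" "\<bar>x$2 - parabola_point a$2\<bar> \<le> d"
      using a by (auto simp: square_def)
    then show "x \<in> cball (parabola_point a) (2 * d)"
      using dist_le_coords[of x "parabola_point a"] by (simp add: dist_commute)
  qed
  then have "emeasure \<sigma> (square d u) \<le> emeasure \<sigma> (cball (parabola_point a) (2 * d))"
    by (intro emeasure_mono) auto
  also have "\<dots> \<le> ennreal ((2 * d) powr s)"
    using fr d by (auto simp: frostman_def)
  also have "(2 * d) powr s \<le> 2 * d powr s"
    using d s powr_mono[of s 1 2] by (simp add: powr_mult)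
  \<comment> \<open>The factor \<open>d / 2\<close> is the length of the parameter interval of
    radius \<open>d / 4\<close> about \<open>a\<close>. Its arc stays in the enlarged square,
    because \<open>b\<^sup>2\<close> differs from \<open>a\<^sup>2\<close> by at most
    \<open>d / 4 * 3\<close>, and \<open>cutoff\<close> is 1 on it.\<close>
  also have "2 * d powr s = 4 * d powr (s - 1) * (d / 2)"
    using d by (simp add: powr_diff)
  also have "ennreal \<dots> = ennreal (4 * d powr (s - 1)) * ennreal (d / 2)"
    using d by (intro ennreal_mult) auto
  also have "ennreal (d / 2) = (\<integral>\<^sup>+ b. indicator {a - d / 4..a + d / 4} b \<partial>lborel)"
    using d by simp
  also have "\<dots> \<le> (\<integral>\<^sup>+ b. ennreal (cutoff b) * indicator (square (4 * d) (u - (d, d))) (parabola_point b) \<partial>lborel)"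
  proof (intro nn_integral_mono)
    fix b :: real
    show "indicator {a - d / 4..a + d / 4} b \<le> ennreal (cutoff b) * indicator (square (4 * d) (u - (d, d))) (parabola_point b)"
    proof (cases "b \<in> {a - d / 4..a + d / 4}")
      case True
      then have "a - d / 4 \<le> b" "b \<le> a + d / 4" by simp_all
      then have ba: "\<bar>b - a\<bar> \<le> d / 4" by linarith
      have *: "\<bar>b\<^sup>2 - a\<^sup>2\<bar> = \<bar>b - a\<bar> * \<bar>b + a\<bar>" by (simp add: abs_mult[symmetric] power2_eq_square algebra_simps)
      have "\<bar>b + a\<bar> \<le> 3" using ba a(1) d by linarith
      with ba have "\<bar>b - a\<bar> * \<bar>b + a\<bar> \<le> d / 4 * 3" using d by (intro mult_mono) auto
      then have "\<bar>b\<^sup>2 - a\<^sup>2\<bar> \<le> d" using d unfolding * by simp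
      then have "parabola_point b \<in> square (4 * d) (u - (d, d))"
        using a(2) ba d unfolding square_def abs_le_iff by simp
      moreover have "\<bar>b\<bar> \<le> 2" using ba a(1) d by linarith
      then have "cutoff b = 1" by (simp add: cutoff_def)
      ultimately show ?thesis by (simp add: indicator_def)
    qed auto
  qed
  also have "\<dots> = emeasure smooth_parabola (square (4 * d) (u - (d, d)))"
    using nn_integral_smooth_parabola[of "indicator (square (4 * d) (u - (d, d)))"] by simp
  finally show ?thesis by (simp add: mult_left_mono ennreal_leI)
qed

lemma emeasure_convolution_square:
  assumes "finite_measure \<mu>" "finite_measure \<sigma>" "sets \<mu> = sets borel" "sets \<sigma> = sets borel"
  shows "emeasure (convolution \<mu> \<sigma>) (square d w) = (\<integral>\<^sup>+ x. emeasure \<sigma> (square d (w - (x$1, x$2))) \<partial>\<mu>)"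
proof -
  have "{a. a + x \<in> square d w} = square d (w - (x$1, x$2))" for x
    by (auto simp: square_def)
  then show ?thesis
    using assms by (subst convolution_emeasure) (auto dest: sets_eq_imp_space_eq)
qed

lemma frostman_convolution_square_le:
  assumes "finite_measure \<mu>" "sets \<mu> = sets borel" "finite_measure \<sigma>"
    and "borel_measure_on parabola \<sigma>" "frostman s \<sigma>" "0 \<le> s" "s \<le> 1" "0 < d" "d \<le> 1"
  shows "emeasure (convolution \<mu> \<sigma>) (square d w)
    \<le> ennreal (4 * d powr (s - 1)) * emeasure (convolution \<mu> smooth_parabola) (square (4 * d) (w - (d, d)))"
proof -
  have sets: "sets \<sigma> = sets borel" using assms by (simp add: borel_measure_on_def)
  interpret finite_measure smooth_parabola by (rule finite_measure_smooth_parabola)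
  have [measurable_cong]: "sets \<mu> = sets borel" by fact
  have "(\<lambda>x. emeasure smooth_parabola (square (4 * d) ((- (x$1, x$2)) + (w - (d, d))))) \<in> borel_measurable \<mu>"
    by (rule measurable_compose[OF _ emeasure_square_measurable[OF finite_measure_smooth_parabola sets_smooth_parabola]])
       (simp add: borel_prod[symmetric])
  moreover have "- (x$1, x$2) + (w - (d, d)) = w - (x$1, x$2) - (d, d)" for x :: "real^2"
    by (simp add: prod_eq_iff)
  ultimately have [measurable]: "(\<lambda>x. emeasure smooth_parabola (square (4 * d) (w - (x$1, x$2) - (d, d)))) \<in> borel_measurable \<mu>"
    by (simp only:)
  have "emeasure (convolution \<mu> \<sigma>) (square d w)
      \<le> (\<integral>\<^sup>+ x. ennreal (4 * d powr (s - 1)) * emeasure smooth_parabola (square (4 * d) (w - (x$1, x$2) - (d, d))) \<partial>\<mu>)"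
    unfolding emeasure_convolution_square[OF assms(1,3,2) sets]
    using assms by (intro nn_integral_mono frostman_square_le) auto
  also have "\<dots> = ennreal (4 * d powr (s - 1)) * (\<integral>\<^sup>+ x. emeasure smooth_parabola (square (4 * d) (w - (x$1, x$2) - (d, d))) \<partial>\<mu>)"
    by (rule nn_integral_cmult) simp
  finally have le: "emeasure (convolution \<mu> \<sigma>) (square d w)
      \<le> ennreal (4 * d powr (s - 1)) * (\<integral>\<^sup>+ x. emeasure smooth_parabola (square (4 * d) (w - (x$1, x$2) - (d, d))) \<partial>\<mu>)" .
  have *: "w - (x$1, x$2) - (d, d) = w - (d, d) - (x$1, x$2)" for x :: "real^2"
    by (simp add: prod_eq_iff)
  have "(\<integral>\<^sup>+ x. emeasure smooth_parabola (square (4 * d) (w - (x$1, x$2) - (d, d))) \<partial>\<mu>)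
      = emeasure (convolution \<mu> smooth_parabola) (square (4 * d) (w - (d, d)))"
    using assms by (subst emeasure_convolution_square) (auto simp: finite_measure_smooth_parabola *)
  then show ?thesis using le by simp
qed

section \<open>Roughness of the convolution with the smooth parabola\<close>

lemma riesz_kernel_measurable [measurable (raw)]:
  assumes [measurable]: "f \<in> borel_measurable M" "g \<in> borel_measurable M"
  shows "(\<lambda>x. riesz_kernel t (f x) (g x)) \<in> borel_measurable M"
proof -
  have "riesz_kernel t x y = (if dist x y = 0 then (if t = 0 then 1 else \<infinity>) else ennreal (dist x y powr (- t)))" for x y
    by (simp add: riesz_kernel_def)
  then show ?thesis by simp
qed

text \<open>Points of the convolution are of the form \<open>x + parabola_point a\<close>, so after
  Tonelli the two inner integrals over the parabola depend on \<open>x - y\<close> alone.\<close>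

lemma pairing_convolution_smooth_parabola:
  assumes fin: "finite_measure \<mu>" and [measurable_cong]: "sets \<mu> = sets borel"
  defines "m \<equiv> convolution \<mu> smooth_parabola"
  shows "pairing d e m m = (\<integral>\<^sup>+ x. \<integral>\<^sup>+ y. correlation d (x$1 - y$1 + fst e) (x$2 - y$2 + snd e) \<partial>\<mu> \<partial>\<mu>)"
proof -
  interpret mu: finite_measure \<mu> by fact
  interpret P: finite_measure smooth_parabola by (rule finite_measure_smooth_parabola)
  interpret m: finite_measure m unfolding m_def using assms by (intro convolution_finite P.finite_measure_axioms) auto
  have [measurable_cong]: "sets m = sets borel" by (simp add: m_def)
  interpret L: pair_sigma_finite "lborel :: real measure" \<mu> ..
  let ?K = "\<lambda>u v :: real^2. ennreal (tent d (u$1 - v$1 + fst e) * tent d (u$2 - v$2 + snd e))"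
  have conv: "(\<integral>\<^sup>+ u. f u \<partial>m) = (\<integral>\<^sup>+ x. \<integral>\<^sup>+ a. ennreal (cutoff a) * f (x + parabola_point a) \<partial>lborel \<partial>\<mu>)"
    if [measurable]: "f \<in> borel_measurable borel" for f :: "real^2 \<Rightarrow> ennreal"
    unfolding m_def using fin assms(2) finite_measure_smooth_parabola
    by (simp add: nn_integral_convolution nn_integral_smooth_parabola)
  have "pairing d e m m = (\<integral>\<^sup>+ x. \<integral>\<^sup>+ a. ennreal (cutoff a) * (\<integral>\<^sup>+ v. ?K (x + parabola_point a) v \<partial>m) \<partial>lborel \<partial>\<mu>)"
    unfolding pairing_def by (rule conv) simp
  also have "\<dots> = (\<integral>\<^sup>+ x. \<integral>\<^sup>+ a. \<integral>\<^sup>+ y. \<integral>\<^sup>+ b. ennreal (cutoff a) * (ennreal (cutoff b) * ?K (x + parabola_point a) (y + parabola_point b)) \<partial>lborel \<partial>\<mu> \<partial>lborel \<partial>\<mu>)"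
    by (simp add: conv nn_integral_cmult del: vector_add_component)
  also have "\<dots> = (\<integral>\<^sup>+ x. \<integral>\<^sup>+ y. \<integral>\<^sup>+ a. \<integral>\<^sup>+ b. ennreal (cutoff a) * (ennreal (cutoff b) * ?K (x + parabola_point a) (y + parabola_point b)) \<partial>lborel \<partial>lborel \<partial>\<mu> \<partial>\<mu>)"
    by (intro nn_integral_cong L.Fubini'[symmetric]) (simp add: split_beta')
  also have "\<dots> = (\<integral>\<^sup>+ x. \<integral>\<^sup>+ y. correlation d (x$1 - y$1 + fst e) (x$2 - y$2 + snd e) \<partial>\<mu> \<partial>\<mu>)"
    unfolding correlation_def
    by (intro nn_integral_cong) (simp add: ennreal_mult cutoff_bounds tent_nonneg mult.assoc algebra_simps)
  finally show ?thesis .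
qed

lemma correlation_measurable [measurable (raw)]:
  assumes [measurable]: "f \<in> borel_measurable M" "g \<in> borel_measurable M"
  shows "(\<lambda>x. correlation d (f x) (g x)) \<in> borel_measurable M"
  unfolding correlation_def by measurable

text \<open>By \<open>roughness_eq\<close> the roughness is twice the loss of \<open>pairing\<close>
  under the displacement \<open>e\<close>. Integrating \<open>correlation_shift\<close> with
  \<open>N = dist x y\<close> bounds this loss by a multiple of the energy.\<close>

lemma roughness_convolution_le:
  assumes fin: "finite_measure \<mu>" and sets [measurable_cong]: "sets \<mu> = sets borel"
    and energy: "riesz_energy t \<mu> \<le> 1" and t: "0 < t" "t \<le> 2"
    and d: "0 < d" and e: "\<bar>fst e\<bar> \<le> d" "\<bar>snd e\<bar> \<le> d"
  shows "roughness d e (convolution \<mu> smooth_parabola) \<le> ennreal (96768 * d ^ 3 * d powr t)"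
proof -
  interpret mu: finite_measure \<mu> by fact
  define m where "m = convolution \<mu> smooth_parabola"
  interpret m: finite_measure m unfolding m_def using assms by (intro convolution_finite finite_measure_smooth_parabola) auto
  interpret mm: two_measures m m by unfold_locales (auto simp: m_def)
  let ?c = "ennreal (48384 * d ^ 3 * d powr t)"
  have "pairing d 0 m m \<le> (\<integral>\<^sup>+ x. \<integral>\<^sup>+ y. correlation d (x$1 - y$1 + fst e) (x$2 - y$2 + snd e) + ?c * riesz_kernel t x y \<partial>\<mu> \<partial>\<mu>)"
    unfolding m_def pairing_convolution_smooth_parabola[OF fin sets]
  proof (intro nn_integral_mono)
    fix x y :: "real^2"
    show "correlation d (x$1 - y$1 + fst 0) (x$2 - y$2 + snd 0)
      \<le> correlation d (x$1 - y$1 + fst e) (x$2 - y$2 + snd e) + ?c * riesz_kernel t x y"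
    proof (cases "x = y")
      case True
      \<comment> \<open>As \<open>t > 0\<close>, the kernel is infinite on the diagonal, where the
        bound is therefore trivial.\<close>
      then have "?c * riesz_kernel t x y = \<infinity>"
        using t d by (simp add: riesz_kernel_def ennreal_mult_top)
      then show ?thesis by simp
    next
      case False
      have "correlation d (x$1 - y$1) (x$2 - y$2) \<le> correlation d (x$1 - y$1 + fst e) (x$2 - y$2 + snd e)
          + ennreal (48384 * d ^ 3 * (d / dist x y) powr t)"
        using d e t False dist_le_coords[of x y] by (intro correlation_shift) auto
      also have "ennreal (48384 * d ^ 3 * (d / dist x y) powr t) = ?c * riesz_kernel t x y"
        using False d by (simp add: riesz_kernel_def ennreal_mult'[symmetric] powr_divide powr_minus field_simps)
      finally show ?thesis by simp
    qed
  qed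
  also have "\<dots> = pairing d e m m + ?c * riesz_energy t \<mu>"
    unfolding m_def pairing_convolution_smooth_parabola[OF fin sets] riesz_energy_def
    by (simp add: nn_integral_add nn_integral_cmult)
  also have "\<dots> \<le> pairing d e m m + ?c"
    using mult_left_mono[OF energy, of ?c] by (intro add_left_mono) simp
  finally have P: "pairing d 0 m m \<le> pairing d e m m + ?c" .
  have "2 * pairing d e m m + roughness d e m = 2 * pairing d 0 m m"
    using roughness_eq[OF m.finite_measure_axioms mm.sets_M, of d e] by (simp add: add.commute)
  also have "\<dots> \<le> 2 * pairing d e m m + 2 * ?c"
    using mult_left_mono[OF P, of 2] by (simp add: distrib_left)
  \<comment> \<open>\<open>2 * pairing d e m m\<close> may be cancelled because it is
    finite.\<close>
  finally have "roughness d e m \<le> 2 * ?c"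
    using mm.pairing_finite[OF d, of e] by (subst (asm) ennreal_add_left_cancel_le) (auto simp: ennreal_mult_eq_top_iff less_top[symmetric])
  also have "2 * ?c = ennreal (96768 * d ^ 3 * d powr t)"
    using d by (simp add: ennreal_mult'[symmetric] ennreal_numeral[symmetric] del: ennreal_numeral)
  finally show ?thesis by (simp add: m_def)
qed

subsection \<open>Summation over dyadic scales\<close>

lemma halves_powr_mult: "((1/2::real) ^ j) powr a * ((1/2) ^ j) powr b = ((1/2) ^ j) powr (a + b)"
  by (simp add: powr_add)

lemma halves_powr_le:
  assumes "0 \<le> a" "i \<le> j" shows "((1/2::real) ^ j) powr a \<le> ((1/2) ^ i) powr a"
  using assms by (intro powr_mono2 power_decreasing) auto

lemma halves_powr_eq: "((1/2::real) ^ j) powr a = ((1/2) powr a) ^ j"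
  by (simp add: powr_powr powr_realpow[symmetric] mult.commute)

lemma sum_halves_powr_le:
  assumes "0 < a" shows "(\<Sum>i=1..j. ((1/2::real) ^ i) powr a) \<le> 1 / (1 - (1/2) powr a)"
proof -
  define q where "q = (1/2::real) powr a"
  have q: "0 < q" "q < 1" using assms powr_less_mono2_neg[of a "1/2" 1] powr_less_mono'[of "1/2" 0 a] by (auto simp: q_def)
  have "(\<Sum>i=1..j. ((1/2::real) ^ i) powr a) = (\<Sum>i=1..j. q ^ i)"
    by (simp add: halves_powr_eq q_def)
  also have "\<dots> \<le> (\<Sum>i. q ^ i)"
    using q by (intro sum_le_suminf summable_geometric) auto
  also have "\<dots> = 1 / (1 - q)" using q by (intro suminf_geometric) auto
  finally show ?thesis by (simp add: q_def)
qed

text \<open>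
  The free parameter l is set to \<open>\<epsilon> * d powr ((t + 1 - z) / 2)\<close> at scale \<open>d\<close>, which balances the two
  error terms; \<open>\<epsilon>\<close> is so small that the induction hypothesis is absorbed.
\<close>
lemma recursion_bound:
  fixes A E :: "nat \<Rightarrow> real"
  assumes K: "0 \<le> K" and z: "z < s + 1" "z < 2 * s + t - 1" "z \<le> 2"
    and E0: "E 0 \<le> K" and A01: "A 0 \<le> K" "A 1 \<le> K"
    and E_step: "\<And>j l. 0 < l \<Longrightarrow>
      16 * E (Suc j) \<le> E j + 16 * (l * A (Suc j) + K * ((1/2) ^ Suc j) powr (t + 3) / (4 * l))"
    and A_step: "\<And>j. A (j + 2) \<le> 4 * ((1/2) ^ (j + 2)) powr (s - 1) * E j"
  shows "A j \<le> (2048 * K + 2 ^ 20 * K * (1 / (1 - (1/2) powr ((2 * s + t - 1 - z) / 2)))\<^sup>2) * ((1/2) ^ j) powr (z + 2)"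
proof -
  let ?h = "\<lambda>j :: nat. (1/2 :: real) ^ j"
  define g where "g = (2 * s + t - 1 - z) / 2"
  define G where "G = 1 / (1 - (1/2 :: real) powr g)"
  \<comment> \<open>The constants satisfy \<open>M = 1024 * (K + B * G)\<close>, which closes the
    induction: with this \<open>\<epsilon>\<close> the part \<open>1024 * G * \<epsilon> * M\<close>
    is \<open>M / 2\<close>, and the rest, \<open>1024 * K + 2 ^ 19 * K * G\<^sup>2\<close>, is the
    other half.\<close>
  define M where "M = 2048 * K + 2 ^ 20 * K * G\<^sup>2"
  define \<epsilon> where "\<epsilon> = 1 / (2048 * G)"
  define B where "B = \<epsilon> * M + K / (4 * \<epsilon>)"
  \<comment> \<open>With the chosen \<open>l\<close> both error terms at scale \<open>d\<close> are
    multiples of \<open>d powr (4 + k)\<close>.\<close>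
  define k where "k = (t + z - 3) / 2"
  have g: "0 < g" using z by (simp add: g_def)
  have "(1/2 :: real) powr g < 1" using g powr_less_mono'[of "1/2" 0 g] by simp
  then have G: "0 < G" by (simp add: G_def)
  have e: "0 < \<epsilon>" using G by (simp add: \<epsilon>_def)
  have KM: "2048 * K \<le> M" using K by (simp add: M_def)
  then have M: "0 \<le> M" using K by linarith
  have B: "0 \<le> B" using M K e by (simp add: B_def)
  \<comment> \<open>Up to errors, halving the scale divides \<open>E\<close> by 16, which gives
    \<open>?h j ^ 4\<close>. The rescaled errors accumulate as powers with exponent
    \<open>k\<close>, which may be negative.\<close>
  have E: "E j \<le> ?h j ^ 4 * (K + B * (\<Sum>i=1..j. ?h i powr k))"
    if "\<And>i. i \<le> j \<Longrightarrow> A i \<le> M * ?h i powr (z + 2)" for j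
    using that
  proof (induction j)
    case 0
    then show ?case using E0 by simp
  next
    case (Suc j)
    define d where "d = ?h (Suc j)"
    have d: "0 < d" by (simp add: d_def)
    define l where "l = \<epsilon> * d powr ((t + 1 - z) / 2)"
    have l: "0 < l" using e d by (simp add: l_def)
    have "l * A (Suc j) \<le> l * (M * d powr (z + 2))"
      using Suc.prems[of "Suc j"] l by (intro mult_left_mono) (auto simp: d_def)
    also have "\<dots> = \<epsilon> * M * (d powr ((t + 1 - z) / 2) * d powr (z + 2))" by (simp add: l_def)
    also have "d powr ((t + 1 - z) / 2) * d powr (z + 2) = d powr (4 + k)"
      by (simp add: powr_add[symmetric] k_def field_simps)
    finally have 1: "l * A (Suc j) \<le> \<epsilon> * M * d powr (4 + k)" .
    have "K * d powr (t + 3) / (4 * l) = K / (4 * \<epsilon>) * (d powr (t + 3) / d powr ((t + 1 - z) / 2))"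
      by (simp add: l_def)
    also have "d powr (t + 3) / d powr ((t + 1 - z) / 2) = d powr (4 + k)"
      by (simp add: powr_diff[symmetric] k_def field_simps)
    finally have 2: "K * d powr (t + 3) / (4 * l) = K / (4 * \<epsilon>) * d powr (4 + k)" .
    have "16 * E (Suc j) \<le> E j + 16 * (B * d powr (4 + k))"
    proof -
      have "l * A (Suc j) + K * d powr (t + 3) / (4 * l) \<le> B * d powr (4 + k)"
        unfolding 2 B_def distrib_right using 1 by (rule add_right_mono)
      then show ?thesis
        by (intro order_trans[OF E_step[OF l, of j, folded d_def]] add_left_mono mult_left_mono) auto
    qed
    also have "E j \<le> ?h j ^ 4 * (K + B * (\<Sum>i=1..j. ?h i powr k))"
      using Suc.prems by (intro Suc.IH) auto
    also have "?h j ^ 4 = 16 * d ^ 4" by (simp add: d_def power_mult_distrib power_divide)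
    also have "16 * d ^ 4 * (K + B * (\<Sum>i=1..j. ?h i powr k)) + 16 * (B * d powr (4 + k))
        = 16 * (d ^ 4 * (K + B * (\<Sum>i=1..Suc j. ?h i powr k)))"
      using d by (simp add: powr_add d_def[symmetric] algebra_simps del: power_Suc)
    finally show ?case unfolding d_def[symmetric] by linarith
  qed
  have "A j \<le> M * ?h j powr (z + 2)"
  \<comment> \<open>\<open>A j\<close> is bounded through \<open>E (j - 2)\<close>, which involves
    \<open>A\<close> up to index \<open>j - 2\<close>; the first two scales use the initial
    bounds.\<close>
  proof (induction j rule: less_induct)
    case (less j)
    consider "j = 0" | "j = 1" | i where "j = i + 2"
      by (metis One_nat_def add_2_eq_Suc' not0_implies_Suc)
    then show ?case
    proof cases
      case 1
      have "K \<le> M" using KM K by linarith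
      then show ?thesis using A01 1 by simp
    next
      case 2
      \<comment> \<open>\<open>z \<le> 2\<close> keeps the power at scale \<open>1/2\<close> at
        least \<open>1 / 16\<close>, while \<open>M\<close> is at least
        \<open>2048 * K\<close>.\<close>
      have "1 / 16 = (1/2::real) powr 4" by (simp add: eval_nat_numeral)
      also have "\<dots> \<le> (1/2) powr (z + 2)" using z by (intro powr_mono') auto
      finally have "M * (1 / 16) \<le> M * (1/2) powr (z + 2)" using M by (intro mult_left_mono) auto
      moreover have "K \<le> M * (1 / 16)" using KM K by linarith
      ultimately show ?thesis using A01 2 by simp
    next
      case 3
      define d where "d = ?h j"
      have d: "0 < d" "d \<le> 1" by (auto simp: d_def power_le_one)
      have "A j \<le> 4 * d powr (s - 1) * E i"
        using A_step[of i] 3 by (simp add: d_def)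
      also have "\<dots> \<le> 4 * d powr (s - 1) * (?h i ^ 4 * (K + B * (\<Sum>n=1..i. ?h n powr k)))"
        using 3 by (intro mult_left_mono E less) auto
      \<comment> \<open>\<open>j = i + 2\<close>, so \<open>?h i = 4 * d\<close>.\<close>
      also have "?h i ^ 4 = 256 * d ^ 4" by (simp add: d_def 3 power_mult_distrib power_divide power_add)
      also have "4 * d powr (s - 1) * (256 * d ^ 4 * (K + B * (\<Sum>n=1..i. ?h n powr k)))
          = 1024 * (d powr (s - 1) * d powr 4) * (K + B * (\<Sum>n=1..i. ?h n powr k))"
        using d by simp
      also have "d powr (s - 1) * d powr 4 = d powr (z + 2) * d powr (s + 1 - z)"
        by (simp add: powr_add[symmetric])
      also have "1024 * (d powr (z + 2) * d powr (s + 1 - z)) * (K + B * (\<Sum>n=1..i. ?h n powr k))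
          = d powr (z + 2) * (1024 * (d powr (s + 1 - z) * K + B * (\<Sum>n=1..i. d powr (s + 1 - z) * ?h n powr k)))"
        by (simp add: algebra_simps sum_distrib_left)
      also have "\<dots> \<le> d powr (z + 2) * (1024 * (1 * K + B * G))"
      proof (intro mult_left_mono add_mono mult_right_mono K B)
        show "d powr (s + 1 - z) \<le> 1" using d z by (intro powr_le1) auto
        \<comment> \<open>As \<open>n < j\<close> and \<open>z < s + 1\<close>, replacing
          \<open>d\<close> by the larger scale \<open>?h n\<close> only increases the power. The
          exponent \<open>s + 1 - z + k\<close> is \<open>g\<close>, which is positive, so the
          accumulated errors become summable.\<close>
        have "(\<Sum>n=1..i. d powr (s + 1 - z) * ?h n powr k) \<le> (\<Sum>n=1..i. ?h n powr (s + 1 - z) * ?h n powr k)"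
          unfolding d_def using z 3 by (intro sum_mono mult_right_mono halves_powr_le) auto
        also have "\<dots> = (\<Sum>n=1..i. ?h n powr g)"
          by (simp add: powr_add[symmetric] k_def g_def field_simps)
        also have "\<dots> \<le> G" unfolding G_def by (rule sum_halves_powr_le[OF g])
        finally show "(\<Sum>n=1..i. d powr (s + 1 - z) * ?h n powr k) \<le> G" .
      qed auto
      also have "1024 * (1 * K + B * G) = M"
        using G by (simp add: B_def M_def \<epsilon>_def field_simps power2_eq_square)
      finally show ?thesis by (simp add: d_def mult.commute)
    qed
  qed
  then show ?thesis by (simp add: M_def G_def g_def)
qed

section \<open>Riesz energy in terms of near pairs\<close>

lemma suminf_ge_1_eq_top:
  fixes f :: "nat \<Rightarrow> ennreal"
  assumes "\<And>j. 1 \<le> f j" shows "(\<Sum>j. f j) = \<infinity>"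
proof -
  have "of_nat n \<le> (\<Sum>j. f j)" for n
  proof -
    have "of_nat n = (\<Sum>j<n. 1 :: ennreal)" by simp
    also have "\<dots> \<le> (\<Sum>j<n. f j)" by (intro sum_mono assms)
    also have "\<dots> \<le> (\<Sum>j. f j)" by (intro sum_le_suminf summableI) auto
    finally show ?thesis .
  qed
  then show ?thesis
    by (metis ennreal_Ex_less_of_nat infinity_ennreal_def leD top.not_eq_extremum)
qed

lemma ennreal_le_suminf: "f j \<le> (\<Sum>i. f i)" for f :: "nat \<Rightarrow> ennreal"
  using sum_le_suminf[OF summableI, of "{j}" f] by simp

text \<open>For \<open>0 < dist x y \<le> 1/2\<close> some scale \<open>j\<close> has indicator 1
  while the next has 0; then \<open>dist x y > (1/2) ^ j / 4\<close>, so this single term dominates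
  the kernel with constant \<open>4 powr z\<close>. The summand 1 covers larger distances. On the
  diagonal the series diverges if \<open>z > 0\<close>, matching the infinite kernel, and the
  summand 1 is enough if \<open>z = 0\<close>.\<close>

lemma riesz_kernel_le:
  assumes "0 \<le> z"
  shows "riesz_kernel z x y \<le> ennreal (4 powr z) *
    (1 + (\<Sum>j. ennreal (((1/2) ^ j) powr (- z)) * indicator {p. dist (fst p) (snd p) \<le> (1/2) ^ j / 2} (x, y)))"
    (is "_ \<le> ennreal ?c * (1 + (\<Sum>j. ?f j))")
proof (cases "x = y")
  case True
  have c1: "1 \<le> ?c" using assms by (intro ge_one_powr_ge_zero) auto
  show ?thesis
  proof (cases "z = 0")
    case True
    then show ?thesis using \<open>x = y\<close> by (simp add: riesz_kernel_def)
  next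
    case False
    have "1 \<le> ?f j" for j
    proof -
      have "1 \<le> ((1/2::real) ^ j) powr (- z)"
        using assms by (simp add: powr_minus powr_le1 power_le_one one_le_inverse)
      then show ?thesis using \<open>x = y\<close> by (simp add: indicator_def)
    qed
    then have "(\<Sum>j. ?f j) = \<infinity>" by (rule suminf_ge_1_eq_top)
    moreover have "ennreal ?c \<noteq> 0" using c1 by simp
    ultimately have "ennreal ?c * (1 + (\<Sum>j. ?f j)) = \<infinity>" by (simp add: ennreal_mult_top)
    then show ?thesis by simp
  qed
next
  case False
  then have r: "0 < dist x y" by simp
  show ?thesis
  proof (cases "dist x y \<le> 1/2")
    case False
    have "dist x y powr (- z) \<le> (1/2) powr (- z)"
      using assms False by (intro powr_mono2') auto
    also have "\<dots> = 2 powr z" by (simp add: powr_minus powr_divide)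
    also have "\<dots> \<le> ?c" using assms by (intro powr_mono2) auto
    finally have "riesz_kernel z x y \<le> ennreal ?c * 1"
      using r by (simp add: riesz_kernel_def ennreal_leI)
    also have "\<dots> \<le> ennreal ?c * (1 + (\<Sum>j. ?f j))" by (intro mult_left_mono) auto
    finally show ?thesis .
  next
    case True
    define P where "P = (\<lambda>n. (1/2::real) ^ n / 2 < dist x y)"
    obtain n where "(1/2::real) ^ n < dist x y * 2" using real_arch_pow_inv[of "dist x y * 2" "1/2"] r by auto
    then have n: "P n" by (simp add: P_def)
    moreover have "\<not> P 0" using True by (simp add: P_def)
    ultimately have "\<exists>j. \<not> P j \<and> P (Suc j)"
      using nat_induct[of "\<lambda>j. \<not> P j" n] by blast
    then obtain j where j: "\<not> P j" "P (Suc j)" by blast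
    have "dist x y powr (- z) \<le> ((1/2) ^ j / 4) powr (- z)"
      using assms j by (intro powr_mono2') (auto simp: P_def)
    moreover have "(h / 4) powr (- z) = ?c * h powr (- z)" if "0 < h" for h :: real
      using that by (simp add: powr_divide powr_minus_divide)
    ultimately have "dist x y powr (- z) \<le> ?c * ((1/2) ^ j) powr (- z)" by simp
    then have "riesz_kernel z x y \<le> ennreal ?c * ?f j"
      using r j by (simp add: riesz_kernel_def P_def ennreal_mult'[symmetric] ennreal_leI)
    also have "\<dots> \<le> ennreal ?c * (1 + (\<Sum>j. ?f j))"
      by (rule mult_left_mono[OF add_increasing[OF zero_le_one ennreal_le_suminf[of ?f j]]]) simp
    finally show ?thesis .
  qed
qed

text \<open>Integrate \<open>riesz_kernel_le\<close> term by term: the gap between \<open>z\<close>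
  and \<open>z'\<close> makes the series geometric with ratio
  \<open>(1/2) powr (z' - z)\<close>.\<close>

lemma riesz_energy_le:
  assumes fin: "finite_measure \<nu>" and [measurable_cong]: "sets \<nu> = sets borel" and z: "0 \<le> z" "z < z'" and L: "0 \<le> L"
    and near: "\<And>j. (\<integral>\<^sup>+ x. \<integral>\<^sup>+ y. indicator {p. dist (fst p) (snd p) \<le> (1/2) ^ j / 2} (x, y) \<partial>\<nu> \<partial>\<nu>)
       \<le> ennreal (L * ((1/2) ^ j) powr z')"
  shows "riesz_energy z \<nu> \<le> ennreal (4 powr z) * (emeasure \<nu> UNIV * emeasure \<nu> UNIV + ennreal (L / (1 - (1/2) powr (z' - z))))"
proof -
  interpret finite_measure \<nu> by fact
  define q where "q = (1/2::real) powr (z' - z)"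
  have q: "0 < q" "q < 1" using z powr_less_mono'[of "1/2" 0 "z' - z"] by (auto simp: q_def)
  have sp: "space \<nu> = UNIV" using assms(2) by (simp add: sets_eq_imp_space_eq)
  define I where "I = (\<lambda>j (x :: real^2) y. indicator {p. dist (fst p) (snd p) \<le> (1/2) ^ j / 2} (x, y) :: ennreal)"
  have I: "I j x y = (if dist x y \<le> (1/2) ^ j / 2 then 1 else 0)" for j x y
    by (simp add: I_def indicator_def)
  have [measurable]: "(\<lambda>p. I j (fst p) (snd p)) \<in> borel_measurable (\<nu> \<Otimes>\<^sub>M \<nu>)" "I j x \<in> borel_measurable \<nu>" for j x
    unfolding I by measurable
  have [measurable]: "(\<lambda>x. \<integral>\<^sup>+ y. I j x y \<partial>\<nu>) \<in> borel_measurable \<nu>" for j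
    by (rule borel_measurable_nn_integral) (simp add: split_beta')
  have "riesz_energy z \<nu> \<le> (\<integral>\<^sup>+ x. \<integral>\<^sup>+ y. ennreal (4 powr z) * (1 + (\<Sum>j. ennreal (((1/2) ^ j) powr (- z)) * I j x y)) \<partial>\<nu> \<partial>\<nu>)"
    unfolding riesz_energy_def I_def by (intro nn_integral_mono riesz_kernel_le z)
  also have "\<dots> = ennreal (4 powr z) * (emeasure \<nu> UNIV * emeasure \<nu> UNIV + (\<Sum>j. ennreal (((1/2) ^ j) powr (- z)) * (\<integral>\<^sup>+ x. \<integral>\<^sup>+ y. I j x y \<partial>\<nu> \<partial>\<nu>)))"
    by (simp add: nn_integral_cmult nn_integral_add nn_integral_suminf sp)
  also have "\<dots> \<le> ennreal (4 powr z) * (emeasure \<nu> UNIV * emeasure \<nu> UNIV + (\<Sum>j. ennreal (L * q ^ j)))"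
  proof (intro mult_left_mono add_left_mono suminf_le summableI)
    fix j
    have "ennreal (((1/2) ^ j) powr (- z)) * (\<integral>\<^sup>+ x. \<integral>\<^sup>+ y. I j x y \<partial>\<nu> \<partial>\<nu>)
      \<le> ennreal (((1/2) ^ j) powr (- z)) * ennreal (L * ((1/2) ^ j) powr z')"
      using near[of j] by (intro mult_left_mono) (auto simp: I_def)
    also have "\<dots> = ennreal (L * (((1/2) ^ j) powr (- z) * ((1/2) ^ j) powr z'))"
      by (simp add: ennreal_mult'[symmetric] ac_simps)
    also have "((1/2) ^ j) powr (- z) * ((1/2) ^ j) powr z' = q ^ j"
      unfolding q_def halves_powr_mult by (simp add: halves_powr_eq)
    finally show "ennreal (((1/2) ^ j) powr (- z)) * (\<integral>\<^sup>+ x. \<integral>\<^sup>+ y. I j x y \<partial>\<nu> \<partial>\<nu>) \<le> ennreal (L * q ^ j)" .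
  qed auto
  also have "(\<Sum>j. ennreal (L * q ^ j)) = ennreal (L / (1 - q))"
    using q L sums_mult[OF geometric_sums[of q], of L] by (intro suminf_ennreal_eq) auto
  finally show ?thesis by (simp add: q_def)
qed

section \<open>Energy of the convolution\<close>

lemma emeasure_convolution_UNIV:
  assumes "finite_measure M" "finite_measure N" "sets M = sets borel" "sets N = sets borel"
  shows "emeasure (convolution M N) UNIV = emeasure M UNIV * emeasure N UNIV"
proof -
  have "space M = UNIV" "space N = UNIV" using assms by (auto dest: sets_eq_imp_space_eq)
  then show ?thesis
    using nn_integral_convolution[of M N "\<lambda>_. 1"] assms
    by (simp add: space_convolution[unfolded space_borel] mult.commute)
qed

text \<open>For points at distance at most \<open>d / 2\<close>, both tents are at least
  \<open>d / 2\<close>.\<close>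

lemma near_pairs_le_pairing:
  assumes fin: "finite_measure \<nu>" and [measurable_cong]: "sets \<nu> = sets borel" and d: "0 < d"
  shows "(\<integral>\<^sup>+ x. \<integral>\<^sup>+ y. indicator {p. dist (fst p) (snd p) \<le> d / 2} (x, y) \<partial>\<nu> \<partial>\<nu>) \<le> ennreal (4 / d\<^sup>2) * pairing d 0 \<nu> \<nu>"
proof -
  interpret finite_measure \<nu> by fact
  have "(\<integral>\<^sup>+ x. \<integral>\<^sup>+ y. indicator {p. dist (fst p) (snd p) \<le> d / 2} (x, y) \<partial>\<nu> \<partial>\<nu>)
      \<le> (\<integral>\<^sup>+ x. \<integral>\<^sup>+ y. ennreal (4 / d\<^sup>2) * ennreal (tent d (x$1 - y$1 + fst (0 :: real \<times> real)) * tent d (x$2 - y$2 + snd (0 :: real \<times> real))) \<partial>\<nu> \<partial>\<nu>)"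
  proof (intro nn_integral_mono)
    fix x y :: "real^2"
    show "indicator {p. dist (fst p) (snd p) \<le> d / 2} (x, y)
        \<le> ennreal (4 / d\<^sup>2) * ennreal (tent d (x$1 - y$1 + fst (0 :: real \<times> real)) * tent d (x$2 - y$2 + snd (0 :: real \<times> real)))"
    proof (cases "dist x y \<le> d / 2")
      case True
      have "\<bar>x$i - y$i\<bar> \<le> d / 2" for i
        using component_le_norm_cart[of "x - y" i] True by (simp add: dist_norm)
      then have "d / 2 \<le> tent d (x$i - y$i)" for i
        unfolding tent_def by (smt (verit) field_sum_of_halves)
      then have "d / 2 * (d / 2) \<le> tent d (x$1 - y$1) * tent d (x$2 - y$2)"
        using d by (intro mult_mono) (auto simp: tent_nonneg)
      then have "1 \<le> 4 / d\<^sup>2 * (tent d (x$1 - y$1) * tent d (x$2 - y$2))"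
        using d by (simp add: field_simps power2_eq_square)
      from ennreal_leI[OF this] show ?thesis
        using d True by (simp add: ennreal_mult'[symmetric])
    qed (simp add: indicator_def)
  qed
  also have "\<dots> = ennreal (4 / d\<^sup>2) * pairing d 0 \<nu> \<nu>"
    unfolding pairing_def by (simp add: nn_integral_cmult)
  finally show ?thesis .
qed

text \<open>Only one factor is passed to the smooth parabola by the Frostman bound; the other is
  enlarged by inclusion to the same square, which yields a mixed pairing. The common shift of both
  squares disappears in the integral over all positions.\<close>

lemma pairing_convolution_le:
  assumes mu: "finite_measure \<mu>" and sets_mu: "sets \<mu> = sets borel" and sigma: "finite_measure \<sigma>"
    and on: "borel_measure_on parabola \<sigma>" and "frostman s \<sigma>" "0 \<le> s" "s \<le> 1" and d: "0 < d" "d \<le> 1"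
  defines "\<nu> \<equiv> convolution \<mu> \<sigma>" and "m \<equiv> convolution \<mu> smooth_parabola"
  shows "pairing d 0 \<nu> \<nu> \<le> ennreal (4 * d powr (s - 1)) * pairing (4 * d) 0 \<nu> m"
proof -
  have sets_sigma: "sets \<sigma> = sets borel" using on by (simp add: borel_measure_on_def)
  have fin: "finite_measure \<nu>" "finite_measure m"
    unfolding \<nu>_def m_def using assms sets_sigma by (intro convolution_finite finite_measure_smooth_parabola; simp)+
  have sets [simp]: "sets \<nu> = sets borel" "sets m = sets borel" by (simp_all add: \<nu>_def m_def)
  interpret nn: two_measures \<nu> \<nu> using fin unfolding two_measures_def two_measures_axioms_def by simp
  interpret nm: two_measures \<nu> m using fin unfolding two_measures_def two_measures_axioms_def by simp
  note [measurable] = emeasure_square_measurable[OF fin(1) sets(1)] emeasure_square_measurable[OF fin(2) sets(2)]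
  let ?a = "- (d, d)"
  have "pairing d 0 \<nu> \<nu> = (\<integral>\<^sup>+ w. emeasure \<nu> (square d w) * emeasure \<nu> (square d w) \<partial>lborel)"
    using nn.nn_integral_squares[of d 0 0] by simp
  also have "\<dots> \<le> (\<integral>\<^sup>+ w. ennreal (4 * d powr (s - 1)) * (emeasure \<nu> (square (4 * d) (w + ?a)) * emeasure m (square (4 * d) (w + ?a))) \<partial>lborel)"
  proof (intro nn_integral_mono)
    fix w
    have "emeasure \<nu> (square d w) \<le> emeasure \<nu> (square (4 * d) (w + ?a))"
      using d by (intro emeasure_mono) (auto simp: square_def)
    moreover have "emeasure \<nu> (square d w) \<le> ennreal (4 * d powr (s - 1)) * emeasure m (square (4 * d) (w + ?a))"
      unfolding \<nu>_def m_def using frostman_convolution_square_le[OF assms(1-9), of w] by (simp only: diff_conv_add_uminus)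
    ultimately have "emeasure \<nu> (square d w) * emeasure \<nu> (square d w)
       \<le> emeasure \<nu> (square (4 * d) (w + ?a)) * (ennreal (4 * d powr (s - 1)) * emeasure m (square (4 * d) (w + ?a)))"
      by (rule mult_mono) auto
    then show "emeasure \<nu> (square d w) * emeasure \<nu> (square d w)
       \<le> ennreal (4 * d powr (s - 1)) * (emeasure \<nu> (square (4 * d) (w + ?a)) * emeasure m (square (4 * d) (w + ?a)))"
      by (simp only: ac_simps)
  qed
  also have "\<dots> = ennreal (4 * d powr (s - 1)) * pairing (4 * d) 0 \<nu> m"
    using nm.nn_integral_squares[of "4 * d" ?a ?a] by (simp add: nn_integral_cmult del: fst_add snd_add)
  finally show ?thesis .
qed

text \<open>On a ball of diameter 2 the kernel is at least \<open>2 powr (- t) \<ge> 1/4\<close>, so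
  the squared mass is at most 4.\<close>

lemma emeasure_le_of_riesz_energy_le:
  assumes on: "borel_measure_on (cball 0 1) \<mu>" and energy: "riesz_energy t \<mu> \<le> 1" and t: "0 < t" "t \<le> 2"
  shows "emeasure \<mu> UNIV \<le> 4"
proof -
  have [measurable_cong]: "sets \<mu> = sets borel" and AE: "AE x in \<mu>. x \<in> cball 0 1"
    using on by (auto simp: borel_measure_on_def)
  have sp: "space \<mu> = UNIV" using \<open>sets \<mu> = sets borel\<close> by (simp add: sets_eq_imp_space_eq)
  have k: "ennreal (1/4) \<le> riesz_kernel t x y" if "x \<in> cball 0 1" "y \<in> cball 0 1" for x y :: "real^2"
  proof (cases "x = y")
    case False
    have "dist x y \<le> 2" using that dist_triangle[of x y 0] by (simp add: dist_commute)
    have "1 / 4 = (2::real) powr (- 2)" by (simp add: powr_minus)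
    also have "\<dots> \<le> 2 powr (- t)" using t by (intro powr_mono) auto
    also have "\<dots> \<le> dist x y powr (- t)" using \<open>dist x y \<le> 2\<close> t False by (intro powr_mono2') auto
    finally show ?thesis using False by (simp add: riesz_kernel_def ennreal_leI)
  qed (use t in \<open>simp add: riesz_kernel_def\<close>)
  have "ennreal (1/4) * (emeasure \<mu> UNIV * emeasure \<mu> UNIV) = (\<integral>\<^sup>+ x. \<integral>\<^sup>+ y. ennreal (1/4) \<partial>\<mu> \<partial>\<mu>)"
    by (simp add: sp ac_simps)
  also have "\<dots> \<le> riesz_energy t \<mu>"
  proof -
    have "(\<integral>\<^sup>+ y. ennreal (1/4) \<partial>\<mu>) \<le> (\<integral>\<^sup>+ y. riesz_kernel t x y \<partial>\<mu>)" if "x \<in> cball 0 1" for x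
    proof (rule nn_integral_mono_AE)
      show "AE y in \<mu>. ennreal (1/4) \<le> riesz_kernel t x y"
        using AE by eventually_elim (rule k[OF that])
    qed
    from nn_integral_mono_AE[OF eventually_mono[OF AE this]] show ?thesis
      unfolding riesz_energy_def by simp
  qed
  finally have le: "ennreal (1/4) * (emeasure \<mu> UNIV * emeasure \<mu> UNIV) \<le> 1" using energy by order
  have "ennreal 4 * (ennreal (1/4) * (emeasure \<mu> UNIV * emeasure \<mu> UNIV)) \<le> ennreal 4 * 1"
    using le by (rule mult_left_mono) simp
  then have sq: "emeasure \<mu> UNIV * emeasure \<mu> UNIV \<le> 4"
    by (simp add: mult.assoc[symmetric] ennreal_mult'[symmetric] del: ennreal_numeral) (simp add: ennreal_numeral)
  show ?thesis
  \<comment> \<open>A mass above 1 is at most its square, which avoids taking a root.\<close>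
  proof (cases "emeasure \<mu> UNIV \<le> 1")
    case True
    then show ?thesis by (rule order_trans) simp
  next
    case False
    then have "emeasure \<mu> UNIV * 1 \<le> emeasure \<mu> UNIV * emeasure \<mu> UNIV" by (intro mult_left_mono) auto
    then show ?thesis using sq by simp
  qed
qed

lemma emeasure_le_of_frostman:
  assumes on: "borel_measure_on parabola \<sigma>" and fr: "frostman s \<sigma>" and s: "0 \<le> s" "s \<le> 1"
  shows "emeasure \<sigma> UNIV \<le> 2"
proof -
  have sets: "sets \<sigma> = sets borel" and AE: "AE x in \<sigma>. x \<in> parabola"
    using on by (auto simp: borel_measure_on_def)
  have sub: "parabola \<subseteq> cball 0 2"
  proof
    fix x assume "x \<in> parabola"
    then obtain a where a: "\<bar>a\<bar> \<le> 1" "x = parabola_point a" by (auto simp: parabola_eq abs_le_iff)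
    then have "a\<^sup>2 \<le> 1" by (simp add: abs_square_le_1)
    then show "x \<in> cball 0 2" using dist_le_coords[of 0 x] a by simp
  qed
  have "emeasure \<sigma> UNIV = emeasure \<sigma> (cball 0 2)"
  proof (rule emeasure_eq_AE)
    show "AE x in \<sigma>. (x \<in> UNIV) = (x \<in> cball 0 2)"
      using AE by eventually_elim (use sub in blast)
  qed (use sets in auto)
  also have "\<dots> \<le> ennreal (2 powr s)" using fr by (simp add: frostman_def)
  also have "\<dots> \<le> ennreal 2" using powr_mono[of s 1 2] s by (intro ennreal_leI) simp
  finally show ?thesis by simp
qed

text \<open>\<open>recursion_bound\<close> is run with \<open>K = 96768\<close>, the constant of
  \<open>roughness_convolution_le\<close>, at an exponent \<open>z'\<close> strictly above
  \<open>z\<close>; \<open>M\<close> is the constant it yields.\<close>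

lemma riesz_energy_convolution_le:
  assumes s: "0 \<le> s" "s \<le> 1" and t: "0 < t" "t \<le> 2"
    and z: "0 \<le> z" "z < z'" "z' < s + 1" "z' < 2 * s + t - 1"
    and mu: "borel_measure_on (cball 0 1) \<mu>" "riesz_energy t \<mu> \<le> 1"
    and sigma: "borel_measure_on parabola \<sigma>" "frostman s \<sigma>"
  defines "M \<equiv> (2048 * 96768 + 2 ^ 20 * 96768 * (1 / (1 - (1/2) powr ((2 * s + t - 1 - z') / 2)))\<^sup>2)"
  shows "riesz_energy z (convolution \<mu> \<sigma>) \<le> ennreal (4 powr z * (64 + 4 * M / (1 - (1/2) powr (z' - z))))"
proof -
  define \<nu> where "\<nu> = convolution \<mu> \<sigma>"
  define m where "m = convolution \<mu> smooth_parabola"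
  have sets_mu: "sets \<mu> = sets borel" and sets_sigma: "sets \<sigma> = sets borel"
    using mu sigma by (simp_all add: borel_measure_on_def)
  have mass: "emeasure \<mu> UNIV \<le> 4" "emeasure \<sigma> UNIV \<le> 2"
    using emeasure_le_of_riesz_energy_le[OF mu t] emeasure_le_of_frostman[OF sigma s] by auto
  have fin_mu: "finite_measure \<mu>" and fin_sigma: "finite_measure \<sigma>"
    using mass sets_eq_imp_space_eq[OF sets_mu] sets_eq_imp_space_eq[OF sets_sigma]
    by (auto intro!: finite_measureI simp: top_unique)
  have fin: "finite_measure \<nu>" "finite_measure m"
    unfolding \<nu>_def m_def using fin_mu fin_sigma sets_mu sets_sigma
    by (intro convolution_finite finite_measure_smooth_parabola; simp)+
  have sets: "sets \<nu> = sets borel" "sets m = sets borel" by (simp_all add: \<nu>_def m_def)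
  interpret nn: two_measures \<nu> \<nu> using fin sets unfolding two_measures_def two_measures_axioms_def by simp
  interpret nm: two_measures \<nu> m using fin sets unfolding two_measures_def two_measures_axioms_def by simp
  have nu8: "emeasure \<nu> UNIV \<le> 8" and m24: "emeasure m UNIV \<le> 24"
    using mult_mono[OF mass] mult_mono[OF mass(1) emeasure_smooth_parabola_le] fin_mu fin_sigma sets_mu sets_sigma
    by (simp_all add: \<nu>_def m_def emeasure_convolution_UNIV finite_measure_smooth_parabola)
  let ?h = "\<lambda>j :: nat. (1/2 :: real) ^ j"
  define A where "A = (\<lambda>j. enn2real (pairing (?h j) 0 \<nu> \<nu>))"
  define E where "E = (\<lambda>j. enn2real (pairing (?h j) 0 \<nu> m))"
  have A: "pairing (?h j) 0 \<nu> \<nu> = ennreal (A j)" for j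
    using nn.pairing_finite[of "?h j" 0] by (simp add: A_def)
  have E: "pairing (?h j) 0 \<nu> m = ennreal (E j)" for j
    using nm.pairing_finite[of "?h j" 0] by (simp add: E_def)
  have pos: "0 \<le> A j" "0 \<le> E j" for j by (simp_all add: A_def E_def)
  have "A j \<le> M * ?h j powr (z' + 2)" for j
    unfolding M_def
  proof (rule recursion_bound[where E = E and s = s and t = t])
    have h1: "ennreal ((?h j)\<^sup>2) \<le> 1" for j
      using ennreal_leI[of "(?h j)\<^sup>2" 1] by (simp add: power_le_one)
    \<comment> \<open>The total masses give \<open>8 * 8\<close> here and \<open>8 * 24\<close> for
      \<open>E 0\<close>, both below the constant from the roughness.\<close>
    have A64: "A j \<le> 96768" for j
    proof -
      have "ennreal (A j) \<le> ennreal ((?h j)\<^sup>2) * (emeasure \<nu> UNIV * emeasure \<nu> UNIV)"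
        unfolding A[symmetric] by (rule nn.pairing_le) simp
      also have "\<dots> \<le> 1 * (8 * 8)" using h1 nu8 by (intro mult_mono) auto
      also have "\<dots> \<le> ennreal 96768" by simp
      finally show ?thesis by (subst (asm) ennreal_le_iff) auto
    qed
    then show "A 0 \<le> 96768" "A 1 \<le> 96768" by auto
    have "ennreal (E 0) \<le> ennreal ((?h 0)\<^sup>2) * (emeasure \<nu> UNIV * emeasure m UNIV)"
      unfolding E[symmetric] by (rule nm.pairing_le) simp
    also have "\<dots> \<le> 1 * (8 * 24)" using h1 nu8 m24 by (intro mult_mono) auto
    also have "\<dots> \<le> ennreal 96768" by simp
    finally show "E 0 \<le> 96768" by (subst (asm) ennreal_le_iff) auto
  next
    fix j and l :: real assume l: "0 < l"
    define d where "d = ?h (Suc j)"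
    have d: "0 < d" by (simp add: d_def)
    let ?R = "96768 * d powr (t + 3)"
    have "roughness d e m \<le> ennreal ?R" if "\<bar>fst e\<bar> \<le> d" "\<bar>snd e\<bar> \<le> d" for e
      using roughness_convolution_le[OF fin_mu sets_mu mu(2) t d that] d
      by (simp add: m_def powr_add ac_simps)
    then have "16 * pairing d 0 \<nu> m \<le> pairing (2 * d) 0 \<nu> m + 16 * (ennreal l * pairing d 0 \<nu> \<nu> + ennreal (?R / (4 * l)))"
      by (intro nm.pairing_double d l) auto
    moreover have "2 * d = ?h j" by (simp add: d_def)
    moreover define r where "r = ?R / (4 * l)"
    ultimately have "16 * ennreal (E (Suc j)) \<le> ennreal (E j) + 16 * (ennreal l * ennreal (A (Suc j)) + ennreal r)"
      unfolding d_def by (simp only: A E)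
    moreover have r: "0 \<le> r" using l by (simp add: r_def)
    ultimately have "ennreal (16 * E (Suc j)) \<le> ennreal (E j + 16 * (l * A (Suc j) + r))"
      using pos l by (simp add: ennreal_mult ennreal_plus)
    then have "16 * E (Suc j) \<le> E j + 16 * (l * A (Suc j) + r)"
      using pos l r by (subst (asm) ennreal_le_iff) auto
    then show "16 * E (Suc j) \<le> E j + 16 * (l * A (Suc j) + 96768 * ?h (Suc j) powr (t + 3) / (4 * l))"
      by (simp only: r_def d_def)
  next
    fix j
    define d where "d = ?h (j + 2)"
    have d: "0 < d" "d \<le> 1" unfolding d_def by (simp, rule power_le_one) auto
    \<comment> \<open>The Frostman bound passes from scale \<open>d\<close> to \<open>4 * d\<close>,
      hence two dyadic steps back.\<close>
    have "4 * d = ?h j" by (simp add: d_def)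
    then have "ennreal (A (j + 2)) \<le> ennreal (4 * d powr (s - 1)) * ennreal (E j)"
      using pairing_convolution_le[OF fin_mu sets_mu fin_sigma sigma s d, folded \<nu>_def m_def]
      unfolding d_def by (simp only: A E)
    then have "ennreal (A (j + 2)) \<le> ennreal (4 * d powr (s - 1) * E j)"
      using pos by (simp add: ennreal_mult)
    then show "A (j + 2) \<le> 4 * ?h (j + 2) powr (s - 1) * E j"
      unfolding d_def[symmetric] using pos by (subst (asm) ennreal_le_iff) auto
  qed (use z s in auto)
  note A_le = this
  have M: "0 \<le> M" by (simp add: M_def)
  have q: "(1/2::real) powr (z' - z) < 1" using z powr_less_mono'[of "1/2" 0 "z' - z"] by simp
  have "riesz_energy z \<nu> \<le> ennreal (4 powr z) * (emeasure \<nu> UNIV * emeasure \<nu> UNIV + ennreal (4 * M / (1 - (1/2) powr (z' - z))))"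
  proof (rule riesz_energy_le[OF fin(1) sets(1) z(1,2)])
    fix j
    have "(\<integral>\<^sup>+ x. \<integral>\<^sup>+ y. indicator {p. dist (fst p) (snd p) \<le> ?h j / 2} (x, y) \<partial>\<nu> \<partial>\<nu>) \<le> ennreal (4 / (?h j)\<^sup>2) * ennreal (A j)"
      unfolding A[symmetric] by (rule near_pairs_le_pairing[OF fin(1) sets(1)]) simp
    also have "\<dots> \<le> ennreal (4 / (?h j)\<^sup>2) * ennreal (M * ?h j powr (z' + 2))"
      by (intro mult_left_mono ennreal_leI A_le) auto
    also have "\<dots> = ennreal (4 / (?h j)\<^sup>2 * (M * ?h j powr (z' + 2)))" by (simp only: ennreal_mult'[symmetric] divide_nonneg_nonneg zero_le_power zero_le_numeral zero_le_power2)
    \<comment> \<open>The normalisation of the near pairs lowers the exponent \<open>z' + 2\<close>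
      to \<open>z'\<close>.\<close>
    also have "4 / (?h j)\<^sup>2 * (M * ?h j powr (z' + 2)) = 4 * M * ?h j powr z'"
      by (simp add: powr_add)
    finally show "(\<integral>\<^sup>+ x. \<integral>\<^sup>+ y. indicator {p. dist (fst p) (snd p) \<le> ?h j / 2} (x, y) \<partial>\<nu> \<partial>\<nu>) \<le> ennreal (4 * M * ?h j powr z')" .
  qed (use M in simp)
  also have "\<dots> \<le> ennreal (4 powr z) * (8 * 8 + ennreal (4 * M / (1 - (1/2) powr (z' - z))))"
    using nu8 by (intro mult_left_mono add_mono mult_mono) auto
  also have "8 * 8 = ennreal 64" by simp
  also have "ennreal (4 powr z) * (ennreal 64 + ennreal (4 * M / (1 - (1/2) powr (z' - z))))
      = ennreal (4 powr z * (64 + 4 * M / (1 - (1/2) powr (z' - z))))"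
    using M q by (simp add: ennreal_mult ennreal_plus del: ennreal_numeral)
  finally show ?thesis by (simp add: \<nu>_def)
qed

theorem proposition1p7:
  fixes s t \<zeta> :: real
  assumes "s \<in> {1/2 <.. 1}"
    and "t \<in> {0 <..< 2}"
    and "0 \<le> \<zeta>"
    and "\<zeta> < min (t + (2 * s - 1)) (s + 1)"
  shows "\<exists>C::real. C > 0 \<and>
    (\<forall>\<mu> \<sigma> :: (real^2) measure.
       borel_measure_on (cball 0 1) \<mu> \<longrightarrow>
       riesz_energy t \<mu> \<le> 1 \<longrightarrow>
       borel_measure_on parabola \<sigma> \<longrightarrow>
       (\<forall>x. \<forall>r>0. emeasure \<sigma> (cball x r) \<le> ennreal (r powr s)) \<longrightarrow>
       riesz_energy \<zeta> (convolution \<mu> \<sigma>) \<le> ennreal C)"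
proof -
  \<comment> \<open>The room between \<open>\<zeta>\<close> and \<open>z\<close> makes the sum over
    scales converge, and the room above \<open>z\<close> makes the recursion close. Both are fixed
    before the measures, as \<open>C\<close> must be.\<close>
  obtain z where z: "\<zeta> < z" "z < min (t + (2 * s - 1)) (s + 1)"
    using dense[OF assms(4)] by blast
  define M where "M = (2048 * 96768 + 2 ^ 20 * 96768 * (1 / (1 - (1/2::real) powr ((2 * s + t - 1 - z) / 2)))\<^sup>2)"
  define C where "C = 4 powr \<zeta> * (64 + 4 * M / (1 - (1/2) powr (z - \<zeta>)))"
  have "0 \<le> M" by (simp add: M_def)
  moreover have "(1/2::real) powr (z - \<zeta>) < 1" using z powr_less_mono'[of "1/2" 0 "z - \<zeta>"] by simp
  ultimately have "C > 0" unfolding C_def by (intro mult_pos_pos add_pos_nonneg) auto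
  moreover have "riesz_energy \<zeta> (convolution \<mu> \<sigma>) \<le> ennreal C"
    if "borel_measure_on (cball 0 1) \<mu>" "riesz_energy t \<mu> \<le> 1" "borel_measure_on parabola \<sigma>"
      "\<forall>x. \<forall>r>0. emeasure \<sigma> (cball x r) \<le> ennreal (r powr s)" for \<mu> \<sigma> :: "(real^2) measure"
    unfolding C_def M_def using assms z that
    by (intro riesz_energy_convolution_le) (auto simp: frostman_def)
  ultimately show ?thesis by blast
qed

end
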